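(* Let $x>y>0$. Then for every $z\in\mathbb{C}\setminus(-\infty,-y]$, the logarithmic mean $L_{x,y}(z)=L(x+z,y+z)$ has the integral representation $$L_{x,y}(z)=L(x,y)+z+\frac{x-y}{\pi}\int_0^\infty\frac{P_{x,y}(s)}{s}\,e^{-sy}\bigl(1-e^{-sz}\bigr)\,ds,$$ where $$P_{x,y}(s)=\int_0^1\sin(\lambda\pi)\,F(\lambda,(x-y)s)\,d\lambda,\qquad F(\lambda,s)=\int_0^1\Bigl(\frac1u-1\Bigr)^{\lambda}\Bigl(1-\frac{\lambda}{1-u}\Bigr)e^{-us}\,du .$$ Consequently, the function $t\mapsto L_{x,y}(t)$ is a Bernstein function of $t>-\min\{x,y\}$.
   Context: For distinct positive $a,b$ the logarithmic mean is $L(a,b)=\dfrac{b-a}{\ln b-\ln a}$. For complex $z\in\mathbb{C}\setminus(-\infty,-y]$, $L(x+z,y+z)=\dfrac{x-y}{\operatorname{Log}(x+z)-\operatorname{Log}(y+z)}$ with $\operatorname{Log}$ the principal logarithm. $F(\lambda,s)$ is defined for $\lambda\in(0,1)$ and $s>0$. A function $f$ is completely monotonic on an interval $I$ if it has derivatives of all orders on $I$ and $(-1)^n f^{(n)}(t)\ge 0$ for all $t\in I$ and all integers $n\ge 0$. A function $f:I\to[0,\infty)$ on an interval $I\subseteq(-\infty,\infty)$ is a Bernstein function on $I$ if it has derivatives of all orders on $I$ and $f'$ is completely monotonic on $I$.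
   Formalization: The integral diverges for z with Re z < -y, so the formula is proved literally for all z in the cut plane with Re z ≥ -y; on the whole cut plane it is proved with the integral replaced by its holomorphic continuation from Re z > -y. *)

theory Defs
  imports "HOL-Analysis.Analysis"
begin

text \<open>The logarithmic mean of distinct positive reals, and its extension to complex arguments
  through the principal logarithm. Both take the junk value 0 for equal arguments.\<close>

definition log_mean :: "real \<Rightarrow> real \<Rightarrow> real" where
  "log_mean a b = (b - a) / (ln b - ln a)"

definition clog_mean :: "complex \<Rightarrow> complex \<Rightarrow> complex" where
  "clog_mean a b = (a - b) / (Ln a - Ln b)"

definition cut_plane :: "real \<Rightarrow> complex set" where
  "cut_plane y = - (complex_of_real ` {..-y})"

definition F_fun :: "real \<Rightarrow> real \<Rightarrow> real" where
  "F_fun lam s =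
     integral {0<..<1} (\<lambda>u. (1/u - 1) powr lam * (1 - lam / (1 - u)) * exp (- (u * s)))"

definition P_fun :: "real \<Rightarrow> real \<Rightarrow> real \<Rightarrow> real" where
  "P_fun x y s = integral {0<..<1} (\<lambda>lam. sin (lam * pi) * F_fun lam ((x - y) * s))"

definition repr_integrand :: "real \<Rightarrow> real \<Rightarrow> complex \<Rightarrow> real \<Rightarrow> complex" where
  "repr_integrand x y z s =
     of_real (P_fun x y s / s * exp (- (s * y))) * (1 - exp (- (of_real s * z)))"

text \<open>\<^term>\<open>D n\<close> is the \<^term>\<open>n\<close>-th derivative of \<^term>\<open>f\<close> on \<^term>\<open>I\<close>,
  one-sided at an endpoint belonging to \<^term>\<open>I\<close>.\<close>

definition derivatives_on :: "(real \<Rightarrow> real) \<Rightarrow> (nat \<Rightarrow> real \<Rightarrow> real) \<Rightarrow> real set \<Rightarrow> bool" where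
  "derivatives_on f D I \<longleftrightarrow>
     (\<forall>t\<in>I. D 0 t = f t) \<and>
     (\<forall>n. \<forall>t\<in>I. (D n has_real_derivative D (Suc n) t) (at t within I))"

definition completely_monotonic_on :: "(real \<Rightarrow> real) \<Rightarrow> real set \<Rightarrow> bool" where
  "completely_monotonic_on f I \<longleftrightarrow>
     is_interval I \<and>
     (\<exists>D. derivatives_on f D I \<and> (\<forall>n. \<forall>t\<in>I. (-1) ^ n * D n t \<ge> 0))"

definition bernstein_on :: "(real \<Rightarrow> real) \<Rightarrow> real set \<Rightarrow> bool" where
  "bernstein_on f I \<longleftrightarrow>
     is_interval I \<and> (\<forall>t\<in>I. f t \<ge> 0) \<and>
     (\<exists>D. derivatives_on f D I \<and> completely_monotonic_on (D 1) I)"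

end

theory Submission
  imports Defs "HOL-Complex_Analysis.Complex_Analysis" "HOL-Real_Asymp.Real_Asymp"
begin

text \<open>
  Put \<open>d = x - y\<close>, \<open>w = (y + z) / d\<close> and \<open>a = Ln (1 + w) - Ln w\<close>, so that the logarithmic mean at
  \<open>z\<close> is \<open>d / a\<close>. Integrating \<open>1 / ((1 - exp (\<zeta> + a)) * \<zeta>)\<close> over the boundary of the strip
  \<open>\<bar>Im \<zeta>\<bar> \<le> \<pi>\<close>, where \<open>exp (\<zeta> + a) = - exp (Re \<zeta> + a)\<close>, the residues at \<open>0\<close> and \<open>-a\<close> give
  \<open>1 / a - w\<close> as the integral of \<open>1 / ((1 + exp (c + a)) * (c\<^sup>2 + \<pi>\<^sup>2))\<close> over real \<open>c\<close>.
  The substitution \<open>u = exp c / (1 + exp c)\<close> turns this into the Stieltjes representation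
  \<open>1 / a = w + 1 / 2 - (\<integral> q u / (w + u) over 0 < u < 1)\<close> with
  \<open>q u = 1 / (\<pi>\<^sup>2 + (ln (1 / u - 1))\<^sup>2)\<close>.
  On the other side, integration by parts in \<open>u\<close> and integration of \<open>sin (\<lambda> * \<pi>) * (1 / u - 1) powr \<lambda>\<close>
  in \<open>\<lambda>\<close> show that \<open>P s / s\<close> is \<open>\<pi> * d\<close> times the Laplace transform of \<open>q\<close> at \<open>d * s\<close>. Since
  \<open>q u / u\<close> is integrable, Fubini identifies the two up to the boundary line \<open>Re z = - y\<close>.
  The Stieltjes form can be differentiated under the integral sign, which gives the Bernstein property.
\<close>

section \<open>Residue calculus on a rectangle of height \<open>2 * pi\<close>\<close>

lemma has_contour_integral_linepath_same_Im_iff: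
  assumes "Im z = c" "Im z' = c" "Re z = a" "Re z' = b" "a < b"
  shows "(f has_contour_integral I) (linepath z z') \<longleftrightarrow>
           ((\<lambda>x. f (Complex x c)) has_integral I) {a..b}"
proof -
  have "(f has_contour_integral I) (linepath z z') \<longleftrightarrow>
          ((\<lambda>x. f (linepath z z' x) * (z' - z)) has_integral I) {0..1}"
    by (subst has_contour_integral_linepath) simp_all
  also have "\<dots> \<longleftrightarrow> ((\<lambda>x. f (Complex (a + (b - a) * x) c) * (b - a)) has_integral I) {0..1}"
    using assms
    by (intro has_integral_cong arg_cong2[of _ _ _ _ "(*)"] arg_cong[of _ _ f])
       (auto simp: linepath_def complex_eq_iff algebra_simps)
  also have "{0..1} = (\<lambda>x. x / (b - a)) ` {0..b-a}"
    using assms by simp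
  also have "((\<lambda>x. f (Complex (a + (b - a) * x) c) * (b - a)) has_integral I) \<dots> \<longleftrightarrow>
             ((\<lambda>x. f (Complex (a + x) c) * (b - a)) has_integral ((b-a) *\<^sub>R I)) {0..b-a}"
    by (subst has_integral_stretch_real_iff) (use assms in simp_all)
  also have "\<dots> \<longleftrightarrow> ((\<lambda>x. of_real (b-a) * f (Complex x c)) has_integral (b-a) *\<^sub>R I) {a..b}"
    by (subst has_integral_shift_real_ivl_iff[where c = "-a"])
       (simp_all add: scaleR_conv_of_real mult_ac)
  also have "\<dots> \<longleftrightarrow> ((\<lambda>x. f (Complex x c)) has_integral I) {a..b}"
    by (subst has_integral_mult_right_iff) (use assms in \<open>auto simp: scaleR_conv_of_real\<close>)
  finally show ?thesis .
qed

lemma one_plus_exp_nonzero: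
  fixes a :: complex
  assumes "\<bar>Im a\<bar> < pi"
  shows "1 + exp a \<noteq> 0"
proof
  assume "1 + exp a = 0"
  then have "exp a = exp (\<i> * of_real pi)"
    by (simp add: add_eq_0_iff)
  then obtain n :: int where n: "a = \<i> * of_real pi + of_int (2 * n) * (of_real pi * \<i>)"
    unfolding exp_eq by (auto simp: algebra_simps)
  then have "Im a = pi * of_int (1 + 2 * n)" by (simp add: algebra_simps)
  with assms have "\<bar>of_int (1 + 2 * n)\<bar> < (1::real)"
    by (simp add: abs_mult)
  then have "\<bar>1 + 2 * n\<bar> < 1" by linarith
  then show False by presburger
qed

lemma exp_eq_1_strip:
  fixes z :: complex
  assumes "exp z = 1" "\<bar>Im z\<bar> < 2 * pi"
  shows "z = 0"
proof -
  from assms(1) obtain n :: int where n: "Re z = 0" "Im z = of_int (2 * n) * pi"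
    by (auto simp: exp_eq_1)
  with assms(2) have "\<bar>of_int n\<bar> < (1::real)" by (simp add: abs_mult)
  then have "n = 0" by linarith
  with n show ?thesis by (simp add: complex_eq_iff)
qed

text \<open>The poles of \<open>K\<close> are 0 and the points
  \<open>-a + 2 * k * pi * \<i>\<close>. Since \<open>\<bar>Im a\<bar> < pi\<close> and
  \<open>R > \<bar>Re a\<bar>\<close>, the rectangle encloses exactly 0 and \<open>-a\<close>; they
  are distinct because \<open>a\<close> is nonzero, so both are simple. The integrability claims for
  the four sides allow the contour integral to be split later.\<close>

lemma logistic_rectangle:
  fixes a :: complex
  assumes a: "\<bar>Im a\<bar> < pi" "a \<noteq> 0" and R: "R > \<bar>Re a\<bar>"
  defines "K \<equiv> \<lambda>z. 1 / ((1 - exp (z + a)) * z)"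
  shows "contour_integral (rectpath (Complex (-R) (-pi)) (Complex R pi)) K
           = 2 * pi * \<i> * (1 / a + 1 / (1 - exp a))"
    and "K contour_integrable_on linepath (Complex (-R) (-pi)) (Complex R (-pi))"
    and "K contour_integrable_on linepath (Complex R (-pi)) (Complex R pi)"
    and "K contour_integrable_on linepath (Complex R pi) (Complex (-R) pi)"
    and "K contour_integrable_on linepath (Complex (-R) pi) (Complex (-R) (-pi))"
proof -
  \<comment> \<open>This open strip is wider than the rectangle, because
    \<open>\<bar>Im a\<bar> < pi\<close>, yet narrow enough that
    \<open>\<bar>Im (z + a)\<bar> < 2 * pi\<close> on it, so \<open>exp (z + a) = 1\<close> happens
    only at \<open>z = -a\<close>.\<close>
  define S where "S = {z. \<bar>Im z\<bar> < 2 * pi - \<bar>Im a\<bar>}"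
  define g where "g = rectpath (Complex (-R) (-pi)) (Complex R pi)"
  have S: "S = {z. Im z < 2 * pi - \<bar>Im a\<bar>} \<inter> {z. Im z > - (2 * pi - \<bar>Im a\<bar>)}"
    unfolding S_def by auto
  have "open S" "convex S"
    unfolding S by (auto intro!: open_Int convex_Int open_halfspace_Im_lt open_halfspace_Im_gt
        convex_halfspace_Im_lt convex_halfspace_Im_gt)
  then have "connected S" by (simp add: convex_connected)
  have exp_ne: "exp (z + a) \<noteq> 1" if "z \<in> S" "z \<noteq> - a" for z
  proof
    assume "exp (z + a) = 1"
    then have "z + a = 0"
      by (rule exp_eq_1_strip) (use that in \<open>auto simp: S_def\<close>)
    with that show False by (simp add: add_eq_0_iff2)
  qed
  have holo: "K holomorphic_on S - {0, -a}"
    unfolding K_def by (intro holomorphic_intros) (use exp_ne in auto)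
  have box: "box (Complex (-R) (-pi)) (Complex R pi) = {z. \<bar>Re z\<bar> < R \<and> \<bar>Im z\<bar> < pi}"
    by (auto simp: in_box_complex_iff)
  have in_box: "0 \<in> box (Complex (-R) (-pi)) (Complex R pi)"
    "-a \<in> box (Complex (-R) (-pi)) (Complex R pi)"
    unfolding box using a R by auto
  have le: "Re (Complex (-R) (-pi)) \<le> Re (Complex R pi)" "Im (Complex (-R) (-pi)) \<le> Im (Complex R pi)"
    using R by auto
  have img: "path_image g \<subseteq> S - {0, -a}"
  proof -
    have "path_image g = cbox (Complex (-R) (-pi)) (Complex R pi) - box (Complex (-R) (-pi)) (Complex R pi)"
      unfolding g_def using le by (rule path_image_rectpath_cbox_minus_box)
    also have "\<dots> \<subseteq> S - {0, -a}"
      using in_box a by (auto simp: S_def in_cbox_complex_iff)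
    finally show ?thesis .
  qed
  have wn0: "\<forall>z. z \<notin> S \<longrightarrow> winding_number g z = 0"
  proof (intro allI impI)
    fix z assume "z \<notin> S"
    then have "z \<notin> cbox (Complex (-R) (-pi)) (Complex R pi)"
      using a by (auto simp: S_def in_cbox_complex_iff)
    then show "winding_number g z = 0"
      unfolding g_def by (rule winding_number_rectpath_outside[OF le])
  qed
  have res0: "residue K 0 = 1 / (1 - exp a)"
  proof (rule residue_simple')
    show "open (S - {-a})" "0 \<in> S - {-a}" using \<open>open S\<close> a by (auto simp: S_def)
    show "K holomorphic_on S - {-a} - {0}"
      using holo by (rule holomorphic_on_subset) auto
    have "1 - exp (0 + a) \<noteq> 0" using exp_ne[of 0] a by (auto simp: S_def)
    then have "((\<lambda>w. 1 / (1 - exp (w + a))) \<longlongrightarrow> 1 / (1 - exp (0 + a))) (at 0)"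
      by (intro tendsto_intros) auto
    moreover have "\<forall>\<^sub>F w in at 0. 1 / (1 - exp (w + a)) = K w * (w - 0)"
      unfolding eventually_at_filter K_def by (auto intro!: always_eventually)
    ultimately show "((\<lambda>w. K w * (w - 0)) \<longlongrightarrow> 1 / (1 - exp a)) (at 0)"
      by (auto elim: Lim_transform_eventually)
  qed
  have res1: "residue K (-a) = 1 / a"
  proof (rule residue_simple')
    show "open (S - {0})" "- a \<in> S - {0}" using \<open>open S\<close> a by (auto simp: S_def)
    show "K holomorphic_on S - {0} - {-a}"
      using holo by (rule holomorphic_on_subset) auto
    \<comment> \<open>The difference quotient of the exponential at \<open>-a\<close> tends to 1,
      and \<open>K w * (w + a)\<close> is -1 divided by this quotient and by \<open>w\<close>. That
      identity holds at every \<open>w\<close>, also where a denominator vanishes, since both sides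
      are then 0.\<close>
    have "((\<lambda>w. exp (w + a)) has_field_derivative 1) (at (-a))"
      by (auto intro!: derivative_eq_intros)
    then have "((\<lambda>w. (exp (w + a) - exp (-a + a)) / (w - - a)) \<longlongrightarrow> 1) (at (-a))"
      by (simp only: has_field_derivative_iff)
    then have "((\<lambda>w. - 1 / ((exp (w + a) - exp (-a + a)) / (w - - a)) / w) \<longlongrightarrow> - 1 / 1 / (-a)) (at (-a))"
      using a by (intro tendsto_intros) auto
    moreover have "\<forall>\<^sub>F w in at (-a). - 1 / ((exp (w + a) - exp (-a + a)) / (w - - a)) / w = K w * (w - - a)"
    proof (rule always_eventually, rule allI)
      fix w
      have "- 1 / ((exp (w + a) - exp (-a + a)) / (w - - a)) / w = - ((w + a) / ((exp (w + a) - 1) * w))"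
        by (simp add: minus_divide_left)
      also have "\<dots> = (w + a) / ((1 - exp (w + a)) * w)"
        by (simp only: minus_divide_right mult_minus_left[symmetric] minus_diff_eq)
      finally have "- 1 / ((exp (w + a) - exp (-a + a)) / (w - - a)) / w = (w + a) / ((1 - exp (w + a)) * w)" .
      then show "- 1 / ((exp (w + a) - exp (-a + a)) / (w - - a)) / w = K w * (w - - a)"
        by (simp add: K_def)
    qed
    ultimately show "((\<lambda>w. K w * (w - - a)) \<longlongrightarrow> 1 / a) (at (-a))"
      by (auto elim: Lim_transform_eventually)
  qed
  have "contour_integral g K = 2 * pi * \<i> * (\<Sum>p\<in>{0, -a}. winding_number g p * residue K p)"
    by (rule Residue_theorem[OF \<open>open S\<close> \<open>connected S\<close> _ holo _ _ img wn0])
       (auto simp: g_def)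
  also have "\<dots> = 2 * pi * \<i> * (1 / a + 1 / (1 - exp a))"
    using a winding_number_rectpath[OF in_box(1)] winding_number_rectpath[OF in_box(2)]
    by (simp add: g_def res0 res1)
  finally show "contour_integral (rectpath (Complex (-R) (-pi)) (Complex R pi)) K
           = 2 * pi * \<i> * (1 / a + 1 / (1 - exp a))" unfolding g_def .
  have "K contour_integrable_on g"
    by (rule contour_integrable_holomorphic_simple[OF holo _ _ img])
       (use \<open>open S\<close> in \<open>auto simp: g_def intro!: open_Diff finite_imp_closed\<close>)
  then show "K contour_integrable_on linepath (Complex (-R) (-pi)) (Complex R (-pi))"
    and "K contour_integrable_on linepath (Complex R (-pi)) (Complex R pi)"
    and "K contour_integrable_on linepath (Complex R pi) (Complex (-R) pi)"
    and "K contour_integrable_on linepath (Complex (-R) pi) (Complex (-R) (-pi))"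
    by (auto simp: g_def rectpath_def Let_def)
qed

text \<open>On the two horizontal sides \<open>exp (z + a)\<close> takes the same value, so
  \<open>K\<close> differs there only in the factor \<open>1 / z\<close>. The difference of
  \<open>1 / (c - pi * \<i>)\<close> and \<open>1 / (c + pi * \<i>)\<close> is
  \<open>2 * pi * \<i>\<close> over the square sum of \<open>c\<close> and \<open>pi\<close>, while
  the vertical sides vanish in the limit.\<close>

lemma logistic_integral_limit:
  fixes a :: complex
  assumes a: "\<bar>Im a\<bar> < pi" "a \<noteq> 0"
  shows "((\<lambda>R. integral {-R..R} (\<lambda>c. 1 / ((1 + exp (of_real c + a)) * of_real (c\<^sup>2 + pi\<^sup>2))))
            \<longlongrightarrow> 1 / a + 1 / (1 - exp a)) at_top"
proof -
  define f where "f = (\<lambda>c::real. 1 / ((1 + exp (of_real c + a)) * of_real (c\<^sup>2 + pi\<^sup>2)))"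
  define K where "K = (\<lambda>z. 1 / ((1 - exp (z + a)) * z))"
  define L where "L = 1 / a + 1 / (1 - exp a)"
  \<comment> \<open>On the vertical sides \<open>Re z + Re a\<close> is at least 1 or at most -1, so
    \<open>exp (z + a)\<close> has norm at least 2 or at most 1/2, and \<open>K\<close> is at most
    \<open>2 / R\<close>. Two sides of length \<open>2 * pi\<close> give \<open>8 * pi / R\<close>;
    division by \<open>2 * pi\<close> leaves \<open>4 / R\<close>.\<close>
  have bound: "norm (integral {-R..R} f - L) \<le> 4 / R" if R: "R \<ge> \<bar>Re a\<bar> + 1" for R
  proof -
    have R0: "R > \<bar>Re a\<bar>" "R > 0" using R by auto
    let ?p1 = "linepath (Complex (-R) (-pi)) (Complex R (-pi))"
    let ?p2 = "linepath (Complex R (-pi)) (Complex R pi)"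
    let ?p3 = "linepath (Complex R pi) (Complex (-R) pi)"
    let ?p4 = "linepath (Complex (-R) pi) (Complex (-R) (-pi))"
    note rect = logistic_rectangle[OF a R0(1), folded K_def]
    have total: "contour_integral ?p1 K + (contour_integral ?p2 K + (contour_integral ?p3 K + contour_integral ?p4 K))
        = 2 * pi * \<i> * L"
      using rect by (simp add: rectpath_def Let_def L_def)
    have "(K has_contour_integral contour_integral ?p1 K) ?p1"
      using rect(2) by (rule has_contour_integral_integral)
    then have "((\<lambda>c. K (Complex c (-pi))) has_integral contour_integral ?p1 K) {-R..R}"
      by (subst (asm) has_contour_integral_linepath_same_Im_iff) (use R0 in auto)
    moreover have "(K has_contour_integral - contour_integral ?p3 K) (linepath (Complex (-R) pi) (Complex R pi))"
      using has_contour_integral_reversepath[OF _ has_contour_integral_integral[OF rect(4)]] by simp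
    then have "((\<lambda>c. K (Complex c pi)) has_integral - contour_integral ?p3 K) {-R..R}"
      by (subst (asm) has_contour_integral_linepath_same_Im_iff) (use R0 in auto)
    ultimately have "((\<lambda>c. K (Complex c (-pi)) - K (Complex c pi)) has_integral
        contour_integral ?p1 K - (- contour_integral ?p3 K)) {-R..R}"
      by (rule has_integral_diff)
    moreover have "K (Complex c (-pi)) - K (Complex c pi) = 2 * pi * \<i> * f c" for c
    proof -
      have e: "exp (Complex c (-pi) + a) = - exp (of_real c + a)" "exp (Complex c pi + a) = - exp (of_real c + a)"
        by (simp_all add: exp_add Complex_eq exp_diff exp_minus)
      have nz: "1 + exp (of_real c + a) \<noteq> 0"
        by (rule one_plus_exp_nonzero) (use a in simp)
      have nz2: "Complex c (-pi) \<noteq> 0" "Complex c pi \<noteq> 0" by (auto simp: complex_eq_iff)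
      have p: "Complex c (-pi) * Complex c pi = of_real (c\<^sup>2 + pi\<^sup>2)"
        "Complex c pi - Complex c (-pi) = 2 * pi * \<i>"
        by (auto simp: complex_eq_iff power2_eq_square)
      have alg: "1 / (E * p) - 1 / (E * q) = (q - p) / (E * (p * q))"
        if "E \<noteq> 0" "p \<noteq> 0" "q \<noteq> 0" for E p q :: complex
        using that by (simp add: divide_simps)
      have "K (Complex c (-pi)) - K (Complex c pi)
          = (Complex c pi - Complex c (-pi)) / ((1 + exp (of_real c + a)) * (Complex c (-pi) * Complex c pi))"
        unfolding K_def e using alg[OF nz nz2] by simp
      then show ?thesis unfolding p f_def by simp
    qed
    ultimately have "((\<lambda>c. 2 * pi * \<i> * f c) has_integral
        contour_integral ?p1 K + contour_integral ?p3 K) {-R..R}"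
      by simp
    then have "((\<lambda>c. f c) has_integral
        (contour_integral ?p1 K + contour_integral ?p3 K) / (2 * pi * \<i>)) {-R..R}"
      using has_integral_mult_right[of "\<lambda>c. 2 * pi * \<i> * f c" _ _ "1 / (2 * pi * \<i>)"] by simp
    then have "integral {-R..R} f = (contour_integral ?p1 K + contour_integral ?p3 K) / (2 * pi * \<i>)"
      by (rule integral_unique)
    also have "\<dots> = L - (contour_integral ?p2 K + contour_integral ?p4 K) / (2 * pi * \<i>)"
      using total by (simp add: field_simps)
    finally have eq: "integral {-R..R} f - L = - ((contour_integral ?p2 K + contour_integral ?p4 K) / (2 * pi * \<i>))"
      by simp
    have lower: "norm (1 - exp (z + a)) \<ge> 1 / 2" if "\<bar>Re z\<bar> = R" for z
    proof (cases "Re z \<ge> 0")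
      case True
      with that R have "Re z + Re a \<ge> 1" by linarith
      then have "exp (Re z + Re a) \<ge> 2" using exp_ge_add_one_self[of "Re z + Re a"] by linarith
      then have "norm (exp (z + a)) \<ge> 2" by simp
      then show ?thesis using norm_triangle_ineq2[of "exp (z + a)" 1] by (simp add: norm_minus_commute)
    next
      case False
      with that R have "Re z + Re a \<le> - 1" by linarith
      then have "exp (- (Re z + Re a)) \<ge> 2" using exp_ge_add_one_self[of "- (Re z + Re a)"] by linarith
      then have "exp (Re z + Re a) \<le> 1 / 2"
        unfolding exp_minus by (simp add: field_simps)
      then have "norm (exp (z + a)) \<le> 1 / 2" by simp
      then show ?thesis using norm_triangle_ineq2[of 1 "exp (z + a)"] by simp
    qed
    have upper: "norm (K z) \<le> 2 / R" if "\<bar>Re z\<bar> = R" for z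
    proof -
      have "norm z \<ge> R" using abs_Re_le_cmod[of z] that by simp
      with lower[OF that] have "norm (1 - exp (z + a)) * norm z \<ge> 1 / 2 * R"
        using R0 by (intro mult_mono) auto
      then have "1 / (norm (1 - exp (z + a)) * norm z) \<le> 1 / (1 / 2 * R)"
        by (intro frac_le) (use R0 in auto)
      then show ?thesis
        by (simp add: K_def norm_divide norm_mult)
    qed
    have seg: "\<bar>Re z\<bar> = R" if "z \<in> closed_segment (Complex c u) (Complex c v)" "\<bar>c\<bar> = R" for z c u v
    proof -
      from that(1) obtain t where "z = (1 - t) *\<^sub>R Complex c u + t *\<^sub>R Complex c v"
        unfolding in_segment by blast
      then have "Re z = (1 - t) * c + t * c" by simp
      then have "Re z = c" by (simp add: algebra_simps)
      with that show ?thesis by simp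
    qed
    have len: "norm (Complex c u - Complex c v) = \<bar>u - v\<bar>" for c u v
      by (subst cmod_eq_Im) auto
    have "norm (contour_integral ?p2 K) \<le> 2 / R * norm (Complex R pi - Complex R (-pi))"
      by (rule has_contour_integral_bound_linepath[OF has_contour_integral_integral[OF rect(3)]])
        (use R0 in \<open>auto intro!: upper seg\<close>)
    moreover have "norm (contour_integral ?p4 K) \<le> 2 / R * norm (Complex (-R) (-pi) - Complex (-R) pi)"
      by (rule has_contour_integral_bound_linepath[OF has_contour_integral_integral[OF rect(5)]])
        (use R0 in \<open>auto intro!: upper seg\<close>)
    ultimately have "norm (contour_integral ?p2 K + contour_integral ?p4 K) \<le> 8 * pi / R"
      unfolding len by (intro order.trans[OF norm_triangle_ineq]) simp
    then have "norm ((contour_integral ?p2 K + contour_integral ?p4 K) / (2 * pi * \<i>)) \<le> 8 * pi / R / (2 * pi)"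
      unfolding norm_divide by (simp add: norm_mult field_simps)
    then show ?thesis unfolding eq norm_minus_cancel by simp
  qed
  have "((\<lambda>R. integral {-R..R} f - L) \<longlongrightarrow> 0) at_top"
  proof (rule Lim_null_comparison)
    show "\<forall>\<^sub>F R in at_top. norm (integral {-R..R} f - L) \<le> 4 / R"
      using bound unfolding eventually_at_top_linorder by blast
    show "((\<lambda>R::real. 4 / R) \<longlongrightarrow> 0) at_top" by real_asymp
  qed
  then show ?thesis unfolding L_def f_def by (simp add: LIM_zero_iff)
qed

section \<open>The Stieltjes density and its integrability\<close>

text \<open>The default value 0 is also the limit at 0 and at 1, where the logarithm diverges, so
  the density is continuous on the closed unit interval.\<close>

definition logit_weight :: "real \<Rightarrow> real" where
  "logit_weight u = (if 0 < u \<and> u < 1 then 1 / (pi\<^sup>2 + (ln (1 / u - 1))\<^sup>2) else 0)"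

lemma logit_weight_nonneg: "logit_weight u \<ge> 0"
  by (simp add: logit_weight_def)

lemma borel_measurable_logit_weight [measurable]: "logit_weight \<in> borel_measurable borel"
  unfolding logit_weight_def by measurable

lemma continuous_on_logit_weight: "continuous_on {0..1} logit_weight"
proof (rule continuous_on_IccI)
  have "((\<lambda>u. 1 / (pi\<^sup>2 + (ln (1 / u - 1))\<^sup>2)) \<longlongrightarrow> 0) (at_right 0)"
    by real_asymp
  moreover have "\<forall>\<^sub>F u in at_right 0. 1 / (pi\<^sup>2 + (ln (1 / u - 1))\<^sup>2) = logit_weight u"
    by (auto simp: logit_weight_def eventually_at_right_field intro!: exI[of _ 1])
  ultimately show "(logit_weight \<longlongrightarrow> logit_weight 0) (at_right 0)"
    by (auto simp: logit_weight_def[of 0] elim: Lim_transform_eventually)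
  have "((\<lambda>u. 1 / (pi\<^sup>2 + (ln (1 / u - 1))\<^sup>2)) \<longlongrightarrow> 0) (at_left 1)"
    by real_asymp
  moreover have "\<forall>\<^sub>F u in at_left 1. 1 / (pi\<^sup>2 + (ln (1 / u - 1))\<^sup>2) = logit_weight u"
    by (auto simp: logit_weight_def eventually_at_left_field intro!: exI[of _ 0])
  ultimately show "(logit_weight \<longlongrightarrow> logit_weight 1) (at_left 1)"
    by (auto simp: logit_weight_def[of 1] elim: Lim_transform_eventually)
next
  fix x :: real assume x: "0 < x" "x < 1"
  have "1 / x - 1 > 0" using x by simp
  then have "((\<lambda>u. 1 / (pi\<^sup>2 + (ln (1 / u - 1))\<^sup>2)) \<longlongrightarrow> 1 / (pi\<^sup>2 + (ln (1 / x - 1))\<^sup>2)) (at x)"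
    using x by (intro tendsto_intros) (auto simp: add_nonneg_eq_0_iff)
  moreover have "\<forall>\<^sub>F u in at x. u \<in> {0<..<1}"
    by (rule eventually_at_in_open') (use x in auto)
  then have "\<forall>\<^sub>F u in at x. 1 / (pi\<^sup>2 + (ln (1 / u - 1))\<^sup>2) = logit_weight u"
    by eventually_elim (auto simp: logit_weight_def)
  ultimately show "(logit_weight \<longlongrightarrow> logit_weight x) (at x)"
    using x by (auto simp: logit_weight_def[of x] elim: Lim_transform_eventually)
qed simp

text \<open>Near 0 the function behaves like the reciprocal of \<open>u\<close> times the squared
  logarithm of \<open>u\<close>. With the additional factor \<open>1 / (1 - u)\<close>, which is at
  least 1, it becomes the derivative of an arctangent with finite limits -1/2 and 1/2 at the
  endpoints, and comparison removes the factor again.\<close>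

lemma set_integrable_logit_weight_over:
  "set_integrable lborel {0<..<1} (\<lambda>u. logit_weight u / u)"
proof -
  have "set_integrable lborel (einterval (ereal 0) (ereal 1)) (\<lambda>u. logit_weight u / (u * (1 - u)))"
  proof (rule interval_integral_FTC_nonneg(1)[where F = "\<lambda>u. - arctan (ln (1 / u - 1) / pi) / pi"])
    fix u assume "ereal 0 < ereal u" "ereal u < ereal 1"
    then have u: "0 < u" "u < 1" by auto
    have pos: "1 / u - 1 > 0" using u by simp
    have nz: "pi\<^sup>2 + (ln (1 / u - 1))\<^sup>2 \<noteq> 0" by (simp add: add_nonneg_eq_0_iff)
    have c: "inverse (1 + (ln (1 / u - 1) / pi)\<^sup>2) = pi\<^sup>2 * logit_weight u"
      using u nz by (simp add: logit_weight_def field_simps power2_eq_square)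
    have "1 / u - 1 = (1 - u) / u" using u by (simp add: field_simps)
    then have e: "1 / (1 / u - 1) * (1 / (u * u)) = 1 / (u * (1 - u))" using u by simp
    have "((\<lambda>u. 1 / u - 1) has_real_derivative - (1 / (u * u))) (at u)"
      using u by (auto intro!: derivative_eq_intros simp: power2_eq_square)
    from DERIV_chain2[OF DERIV_ln_divide[OF pos] this]
    have "((\<lambda>u. ln (1 / u - 1) / pi) has_real_derivative 1 / (1 / u - 1) * (- (1 / (u * u))) / pi) (at u)"
      by (rule DERIV_cdivide)
    from DERIV_minus[OF DERIV_cdivide[OF DERIV_chain2[OF DERIV_arctan this], of pi]]
    have "((\<lambda>u. - arctan (ln (1 / u - 1) / pi) / pi) has_real_derivative
       - (inverse (1 + (ln (1 / u - 1) / pi)\<^sup>2) * (1 / (1 / u - 1) * (- (1 / (u * u))) / pi)) / pi) (at u)"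
      by simp
    also have "- (inverse (1 + (ln (1 / u - 1) / pi)\<^sup>2) * (1 / (1 / u - 1) * (- (1 / (u * u))) / pi)) / pi
        = logit_weight u * (1 / (1 / u - 1) * (1 / (u * u)))"
      unfolding c by (simp add: power2_eq_square)
    also have "\<dots> = logit_weight u / (u * (1 - u))" unfolding e by simp
    finally show "((\<lambda>u. - arctan (ln (1 / u - 1) / pi) / pi) has_real_derivative
       logit_weight u / (u * (1 - u))) (at u)" .
    have "isCont logit_weight u"
      using continuous_on_interior[OF continuous_on_logit_weight] u by simp
    then show "isCont (\<lambda>u. logit_weight u / (u * (1 - u))) u"
      using u by (intro continuous_intros) auto
  next
    show "(((\<lambda>u. - arctan (ln (1 / u - 1) / pi) / pi) \<circ> real_of_ereal) \<longlongrightarrow> - 1 / 2) (at_right (ereal 0))"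
    proof -
      have "filterlim (\<lambda>u. ln (1 / u - 1) / pi) at_top (at_right (0::real))" by real_asymp
      then have "((\<lambda>u. - arctan (ln (1 / u - 1) / pi) / pi) \<longlongrightarrow> - (pi / 2) / pi) (at_right 0)"
        by (intro tendsto_intros filterlim_compose[OF tendsto_arctan_at_top]) auto
      then show ?thesis unfolding ereal_tendsto_simps1 by simp
    qed
    show "(((\<lambda>u. - arctan (ln (1 / u - 1) / pi) / pi) \<circ> real_of_ereal) \<longlongrightarrow> 1 / 2) (at_left (ereal 1))"
    proof -
      have "filterlim (\<lambda>u. ln (1 / u - 1) / pi) at_bot (at_left (1::real))" by real_asymp
      then have "((\<lambda>u. - arctan (ln (1 / u - 1) / pi) / pi) \<longlongrightarrow> - (- (pi / 2)) / pi) (at_left 1)"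
        by (intro tendsto_intros filterlim_compose[OF tendsto_arctan_at_bot]) auto
      then show ?thesis unfolding ereal_tendsto_simps1 by simp
    qed
  qed (auto simp: logit_weight_nonneg)
  then have "set_integrable lborel {0<..<1} (\<lambda>u. logit_weight u / (u * (1 - u)))"
    by simp
  then show ?thesis
  proof (rule set_integrable_bound)
    show "set_borel_measurable lborel {0<..<1} (\<lambda>u. logit_weight u / u)"
      unfolding set_borel_measurable_def by measurable
    show "AE u in lborel. u \<in> {0<..<1} \<longrightarrow>
        norm (logit_weight u / u) \<le> norm (logit_weight u / (u * (1 - u)))"
      by (intro AE_I2 impI)
        (auto simp: logit_weight_nonneg abs_mult intro!: divide_left_mono mult_pos_pos mult_left_le)
  qed
qed

section \<open>Stieltjes representation of the reciprocal difference of logarithms\<close>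

text \<open>This places \<open>a\<close> in the strip that the residue computation requires. For
  \<open>Im w > 0\<close> both arguments lie strictly between 0 and \<open>pi\<close>, so their
  difference is less than \<open>pi\<close> in modulus; the lower half plane follows by conjugation,
  and for positive \<open>w\<close> both arguments are 0.\<close>

lemma Ln_diff_properties:
  fixes w :: complex
  assumes w: "w \<notin> \<real>\<^sub>\<le>\<^sub>0"
  defines "a \<equiv> Ln (1 + w) - Ln w"
  shows "\<bar>Im a\<bar> < pi" "a \<noteq> 0" "exp a = (1 + w) / w"
proof -
  have nz: "w \<noteq> 0" "1 + w \<noteq> 0"
    using w by (auto simp: complex_nonpos_Reals_iff complex_eq_iff)
  show e: "exp a = (1 + w) / w" using nz by (simp add: a_def exp_diff)
  then show "a \<noteq> 0" using nz by (auto simp: field_simps)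
  show "\<bar>Im a\<bar> < pi"
  proof (cases "Im w" "0 :: real" rule: linorder_cases)
    case equal
    with w have "Re w > 0" by (auto simp: complex_nonpos_Reals_iff)
    with equal show ?thesis using Im_Ln_eq_0[of w] Im_Ln_eq_0[of "1 + w"] nz by (simp add: a_def)
  next
    case greater
    then show ?thesis using Im_Ln_pos_lt_imp[of w] Im_Ln_pos_lt_imp[of "1 + w"] by (simp add: a_def) linarith
  next
    case less
    have "w \<notin> \<real>\<^sub>\<le>\<^sub>0" "1 + w \<notin> \<real>\<^sub>\<le>\<^sub>0" using less by (auto simp: complex_nonpos_Reals_iff)
    then have "cnj (Ln w) = Ln (cnj w)" "cnj (Ln (1 + w)) = Ln (cnj (1 + w))" by (simp_all add: cnj_Ln)
    then have "Im (Ln w) = - Im (Ln (cnj w))" "Im (Ln (1 + w)) = - Im (Ln (cnj (1 + w)))"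
      by (metis complex_cnj_cnj cnj.sel(2))+
    then show ?thesis
      using less Im_Ln_pos_lt_imp[of "cnj w"] Im_Ln_pos_lt_imp[of "cnj (1 + w)"] by (simp add: a_def) linarith
  qed
qed

text \<open>This is the inverse of the map from \<open>u\<close> to \<open>- ln (1 / u - 1)\<close>.
  It carries the real line onto the open unit interval and turns the logarithm in
  \<open>logit_weight\<close> into the plain variable, up to sign.\<close>

definition logistic :: "real \<Rightarrow> real" where "logistic c = exp c / (1 + exp c)"

lemma logistic_bounds: "0 < logistic c" "logistic c < 1"
  by (simp_all add: logistic_def field_simps add_pos_pos)

lemma one_minus_logistic: "1 - logistic c = 1 / (1 + exp c)"
proof -
  have "1 + exp c \<noteq> 0" using exp_gt_zero[of c] by linarith
  then show ?thesis by (simp add: logistic_def divide_simps)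
qed

lemma logit_weight_logistic: "logit_weight (logistic c) = 1 / (c\<^sup>2 + pi\<^sup>2)"
proof -
  have "1 / logistic c - 1 = exp (-c)"
    by (simp add: logistic_def field_simps exp_minus)
  then show ?thesis using logistic_bounds[of c] by (simp add: logit_weight_def add.commute)
qed

lemma has_field_derivative_logistic:
  "(logistic has_field_derivative logistic c * (1 - logistic c)) (at c within S)"
proof -
  have "1 + exp c \<noteq> 0" using exp_gt_zero[of c] by linarith
  then show ?thesis
    unfolding one_minus_logistic unfolding logistic_def
    by (auto intro!: derivative_eq_intros simp: field_simps)
qed

lemma logistic_Icc_subset: "{logistic c..logistic d} \<subseteq> {0<..<1}"
  using logistic_bounds(1)[of c] logistic_bounds(2)[of d] by auto

lemma logistic_mono: "c \<le> d \<Longrightarrow> logistic c \<le> logistic d"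
  by (rule DERIV_nonneg_imp_nondecreasing) 
    (auto intro!: exI has_field_derivative_logistic simp: less_imp_le logistic_bounds)

lemma logistic_substitution:
  fixes f :: "real \<Rightarrow> 'a::euclidean_space"
  assumes "continuous_on {0<..<1} f" "R \<ge> 0"
  shows "((\<lambda>c. (logistic c * (1 - logistic c)) *\<^sub>R f (logistic c)) has_integral
            integral {logistic (-R)..logistic R} f) {-R..R}"
proof (rule has_integral_substitution)
  show "logistic ` {-R..R} \<subseteq> {logistic (-R)..logistic R}" by (auto intro: logistic_mono)
  show "continuous_on {logistic (-R)..logistic R} f"
    using assms(1) by (rule continuous_on_subset) (rule logistic_Icc_subset)
qed (use assms in \<open>auto intro: has_field_derivative_logistic logistic_mono\<close>)

text \<open>After the logistic substitution the integrand is \<open>?k\<close>. Reflection at 0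
  preserves the symmetric interval, and the factors \<open>1 / (1 + exp c)\<close> and
  \<open>1 / (1 + exp (-c))\<close> add up to 1, so twice the integral is an arctangent integral.
  Its limit produces the constant 1/2 in \<open>inverse_Ln_diff\<close>.\<close>

lemma integral_logit_weight_over:
  assumes "R \<ge> 0"
  shows "integral {logistic (-R)..logistic R} (\<lambda>u. logit_weight u / u) = arctan (R / pi) / pi"
proof -
  let ?k = "\<lambda>c. 1 / ((1 + exp c) * (c\<^sup>2 + pi\<^sup>2))"
  let ?I = "integral {logistic (-R)..logistic R} (\<lambda>u. logit_weight u / u)"
  have "continuous_on {0<..<1} (\<lambda>u. logit_weight u / u)"
    by (intro continuous_intros continuous_on_subset[OF continuous_on_logit_weight]) auto
  from logistic_substitution[OF this assms]
  have 1: "(?k has_integral ?I) {-R..R}"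
  proof (rule has_integral_eq[rotated])
    fix c :: real
    have "(logistic c * (1 - logistic c)) *\<^sub>R (logit_weight (logistic c) / logistic c)
        = (1 - logistic c) * logit_weight (logistic c)"
      using logistic_bounds[of c] by simp
    then show "(logistic c * (1 - logistic c)) *\<^sub>R (logit_weight (logistic c) / logistic c) = ?k c"
      by (simp add: one_minus_logistic logit_weight_logistic)
  qed
  then have 2: "((\<lambda>c. ?k (- c)) has_integral ?I) {-R..R}"
    using has_integral_reflect_real[of ?k ?I R "-R"] by simp
  have "?k c + ?k (- c) = 1 / (c\<^sup>2 + pi\<^sup>2)" for c
  proof -
    have "1 / (1 + exp c) + 1 / (1 + exp (-c)) = 1"
    proof -
      have "1 + exp c \<noteq> 0" using exp_gt_zero[of c] by linarith
      then have "1 / (1 + exp (-c)) = logistic c"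
        by (simp add: logistic_def exp_minus divide_simps)
      then show ?thesis using one_minus_logistic[of c] by simp
    qed
    then have "(1 / (1 + exp c) + 1 / (1 + exp (-c))) * (1 / (c\<^sup>2 + pi\<^sup>2)) = 1 / (c\<^sup>2 + pi\<^sup>2)" by simp
    then show ?thesis
      by (simp only: distrib_right times_divide_times_eq mult_1 power2_minus)
  qed
  with has_integral_add[OF 1 2] have "((\<lambda>c. 1 / (c\<^sup>2 + pi\<^sup>2)) has_integral ?I + ?I) {-R..R}"
    by simp
  moreover have "((\<lambda>c. 1 / (c\<^sup>2 + pi\<^sup>2)) has_integral arctan (R / pi) / pi - arctan (-R / pi) / pi) {-R..R}"
  proof (rule fundamental_theorem_of_calculus)
    fix c
    have "c\<^sup>2 + pi\<^sup>2 \<noteq> 0" by (simp add: add_nonneg_eq_0_iff)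
    then have e: "inverse (1 + (c / pi)\<^sup>2) = pi\<^sup>2 / (c\<^sup>2 + pi\<^sup>2)"
      by (simp add: field_simps)
    have "((\<lambda>c. arctan (c / pi) / pi) has_real_derivative inverse (1 + (c / pi)\<^sup>2) * (1 / pi) / pi) (at c within {-R..R})"
      by (auto intro!: derivative_eq_intros)
    then show "((\<lambda>c. arctan (c / pi) / pi) has_vector_derivative 1 / (c\<^sup>2 + pi\<^sup>2)) (at c within {-R..R})"
      unfolding e by (simp add: has_real_derivative_iff_has_vector_derivative power2_eq_square)
  qed (use assms in auto)
  ultimately have "?I + ?I = arctan (R / pi) / pi - arctan (-R / pi) / pi"
    by (rule has_integral_unique)
  then show ?thesis by (simp add: arctan_minus)
qed

text \<open>From \<open>exp a = (1 + w) / w\<close> follows \<open>1 / (1 - exp a) = - w\<close>, so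
  the limit in \<open>logistic_integral_limit\<close> is \<open>1 / a - w\<close>. In the variable
  \<open>u\<close> its integrand is \<open>logit_weight u\<close> times
  \<open>1 / u - 1 / (w + u)\<close>; the first term does not involve \<open>w\<close> and has total
  mass 1/2.\<close>

lemma inverse_Ln_diff:
  fixes w :: complex
  assumes w: "w \<notin> \<real>\<^sub>\<le>\<^sub>0"
  shows "1 / (Ln (1 + w) - Ln w) = w + 1 / 2 - integral {0..1} (\<lambda>u. of_real (logit_weight u) / (w + of_real u))"
proof -
  define a where "a = Ln (1 + w) - Ln w"
  note a = Ln_diff_properties[OF w, folded a_def]
  have nz: "w \<noteq> 0" "1 + w \<noteq> 0"
    using w by (auto simp: complex_nonpos_Reals_iff complex_eq_iff)
  have wu: "w + of_real u \<noteq> 0" if "u \<ge> 0" for u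
    using w that by (auto simp: complex_nonpos_Reals_iff complex_eq_iff)
  define h where "h = (\<lambda>u. of_real (logit_weight u) / (w + of_real u))"
  have cont_h: "continuous_on {0..1} h"
    unfolding h_def by (intro continuous_intros continuous_on_logit_weight) (use wu in auto)
  have eq: "integral {-R..R} (\<lambda>c. 1 / ((1 + exp (of_real c + a)) * of_real (c\<^sup>2 + pi\<^sup>2)))
      = of_real (arctan (R / pi) / pi) - (integral {0..logistic R} h - integral {0..logistic (-R)} h)"
    if R: "R \<ge> 0" for R
  proof -
    have c1: "continuous_on {0<..<1} (\<lambda>u. logit_weight u / u)"
      by (intro continuous_intros continuous_on_subset[OF continuous_on_logit_weight]) auto
    have c2: "continuous_on {0<..<1} h"
      using cont_h by (rule continuous_on_subset) auto
    have sub: "{logistic (-R)..logistic R} \<subseteq> {0<..<1}"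
      by (rule logistic_Icc_subset)
    have hi: "((\<lambda>c. (logistic c * (1 - logistic c)) *\<^sub>R (of_real (logit_weight (logistic c) / logistic c) - h (logistic c)))
        has_integral integral {logistic (-R)..logistic R} (\<lambda>u. of_real (logit_weight u / u) - h u)) {-R..R}"
      by (rule logistic_substitution) (use c1 c2 R in \<open>auto intro!: continuous_intros simp del: of_real_divide\<close>)
    \<comment> \<open>With \<open>E = exp c\<close> and \<open>v = E / (1 + E)\<close>, both
      \<open>w * (1 + exp (c + a))\<close> and \<open>(w + v) * (1 + E)\<close> equal
      \<open>w * (1 + E) + E\<close>. Hence \<open>1 / (1 + exp (c + a))\<close> is
      \<open>w / (w + v) * (1 - v)\<close>, and partial fractions in \<open>v\<close> give the
      claim.\<close>
    have pt: "(logistic c * (1 - logistic c)) *\<^sub>R (of_real (logit_weight (logistic c) / logistic c) - h (logistic c))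
      = 1 / ((1 + exp (of_real c + a)) * of_real (c\<^sup>2 + pi\<^sup>2))" for c
    proof -
      define v where "v = complex_of_real (logistic c)"
      define E where "E = complex_of_real (exp c)"
      have E1: "1 + E \<noteq> 0"
        using exp_gt_zero[of c] by (metis E_def add_pos_pos less_irrefl of_real_1 of_real_add of_real_eq_0_iff zero_less_one)
      have v0: "v \<noteq> 0" using logistic_bounds[of c] by (simp add: v_def)
      have vE: "v = E / (1 + E)" by (simp add: v_def E_def logistic_def)
      have v1: "1 - v = 1 / (1 + E)" unfolding vE using E1 by (simp add: divide_simps)
      have v2: "w + v \<noteq> 0" unfolding v_def using logistic_bounds[of c] by (intro wu) simp
      have "w * exp (of_real c + a) = E * (1 + w)"
        using nz by (simp add: exp_add a E_def exp_of_real)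
      then have *: "w * (1 + exp (of_real c + a)) = (w + v) * (1 + E)"
      proof -
        have "v * (1 + E) = E" unfolding vE using E1 by simp
        then have "(w + v) * (1 + E) = w * (1 + E) + E" by (simp add: distrib_right[of w v])
        with \<open>w * exp (of_real c + a) = E * (1 + w)\<close> show ?thesis by (simp add: algebra_simps)
      qed
      then have e1: "1 + exp (of_real c + a) \<noteq> 0"
        using v2 E1 by auto
      have "w / (w + v) * (1 - v) = w / ((w + v) * (1 + E))"
        unfolding v1 by simp
      then have "w / (w + v) * (1 - v) = 1 / (1 + exp (of_real c + a))"
        unfolding *[symmetric] using nz by simp
      moreover have "1 / v - 1 / (w + v) = w / (v * (w + v))"
        using v0 v2 by (simp add: divide_simps)
      then have "v * (1 - v) * (1 / v - 1 / (w + v)) = w / (w + v) * (1 - v)"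
        using v0 by simp
      ultimately have "v * (1 - v) * (1 / v - 1 / (w + v)) * (1 / of_real (c\<^sup>2 + pi\<^sup>2))
          = 1 / (1 + exp (of_real c + a)) * (1 / of_real (c\<^sup>2 + pi\<^sup>2))" by simp
      moreover have "k * (1 / D / p - 1 / D / q) = k * (1 / p - 1 / q) * (1 / D)" for k D p q :: complex
        by (simp add: algebra_simps)
      ultimately show ?thesis
        by (simp only: h_def logit_weight_logistic scaleR_conv_of_real of_real_mult of_real_diff
            of_real_1 of_real_divide v_def[symmetric] times_divide_times_eq mult_1)
    qed
    have "integral {-R..R} (\<lambda>c. 1 / ((1 + exp (of_real c + a)) * of_real (c\<^sup>2 + pi\<^sup>2)))
        = integral {logistic (-R)..logistic R} (\<lambda>u. of_real (logit_weight u / u) - h u)"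
      using hi unfolding pt by (rule integral_unique)
    also have "\<dots> = integral {logistic (-R)..logistic R} (\<lambda>u. of_real (logit_weight u / u)) - integral {logistic (-R)..logistic R} h"
      by (intro integral_diff integrable_continuous_real continuous_on_of_real continuous_on_subset[OF c1 sub] continuous_on_subset[OF c2 sub])
    also have "integral {logistic (-R)..logistic R} (\<lambda>u. complex_of_real (logit_weight u / u)) = of_real (arctan (R / pi) / pi)"
      using integral_linear[OF integrable_continuous_real[OF continuous_on_subset[OF c1 sub]]
          bounded_linear_of_real[where 'a = complex]]
      by (simp only: o_def integral_logit_weight_over[OF R])
    also have "integral {logistic (-R)..logistic R} h = integral {0..logistic R} h - integral {0..logistic (-R)} h"
      using Henstock_Kurzweil_Integration.integral_combine[of 0 "logistic (-R)" "logistic R" h]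
        logistic_bounds[of R] logistic_bounds[of "-R"] logistic_mono[of "-R" R] R
        integrable_continuous_real[OF continuous_on_subset[OF cont_h, of "{0..logistic R}"]]
      by (auto simp: less_imp_le algebra_simps)
    finally show ?thesis .
  qed
  \<comment> \<open>Both endpoints of the \<open>u\<close>-interval move with \<open>R\<close>.
    Continuity of the indefinite integral at 1 and at 0 settles the limit of the part with
    \<open>h\<close>.\<close>
  have ch: "continuous_on {0..1} (\<lambda>v. integral {0..v} h)"
    by (intro indefinite_integral_continuous_1 integrable_continuous_real cont_h)
  have l: "(logistic \<longlongrightarrow> 1) at_top" "((\<lambda>R. logistic (-R)) \<longlongrightarrow> 0) at_top"
    unfolding logistic_def by real_asymp+
  have "((\<lambda>R. of_real (arctan (R / pi) / pi) - (integral {0..logistic R} h - integral {0..logistic (-R)} h))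
      \<longlongrightarrow> of_real (1 / 2) - (integral {0..1} h - 0)) at_top"
  proof (intro tendsto_diff tendsto_of_real)
    show "((\<lambda>R. arctan (R / pi) / pi) \<longlongrightarrow> 1 / 2) at_top"
    proof -
      have "filterlim (\<lambda>R. R / pi) at_top at_top" by real_asymp
      then have "((\<lambda>R. arctan (R / pi) / pi) \<longlongrightarrow> pi / 2 / pi) at_top"
        by (intro tendsto_intros filterlim_compose[OF tendsto_arctan_at_top]) auto
      then show ?thesis by simp
    qed
    show "((\<lambda>R. integral {0..logistic R} h) \<longlongrightarrow> integral {0..1} h) at_top"
      by (rule continuous_on_tendsto_compose[OF ch l(1)]) (auto simp: less_imp_le logistic_bounds)
    show "((\<lambda>R. integral {0..logistic (-R)} h) \<longlongrightarrow> 0) at_top"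
      using continuous_on_tendsto_compose[OF ch l(2)] by (simp add: less_imp_le logistic_bounds)
  qed
  then have "((\<lambda>R. integral {-R..R} (\<lambda>c. 1 / ((1 + exp (of_real c + a)) * of_real (c\<^sup>2 + pi\<^sup>2))))
      \<longlongrightarrow> of_real (1 / 2) - integral {0..1} h) at_top"
    unfolding diff_0_right by (rule Lim_transform_eventually)
      (use eq in \<open>auto simp: eventually_at_top_linorder intro!: exI[of _ 0]\<close>)
  with logistic_integral_limit[OF a(1,2)]
  have "1 / a + 1 / (1 - exp a) = of_real (1 / 2) - integral {0..1} h"
    by (rule tendsto_unique[rotated]) simp
  moreover have "1 / (1 - exp a) = - w" using nz by (simp add: a(3) field_simps)
  ultimately have "1 / a + - w = 1 / 2 - integral {0..1} h" by simp
  then have "(1 / a + - w) + w = 1 / 2 - integral {0..1} h + w" by (rule arg_cong)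
  then have "1 / a = w + 1 / 2 - integral {0..1} h"
    by (simp only: add.assoc add.left_inverse add_0_right) (simp only: add_diff_eq add.commute diff_add_eq)
  then show ?thesis unfolding a_def h_def .
qed

section \<open>The kernel \<open>P_fun\<close> as a Laplace transform\<close>

text \<open>With \<open>r = ln (1 / u - 1)\<close> the product of powers is
  \<open>u * exp (l * r)\<close>, so the integrand is \<open>u\<close> times the imaginary part of
  \<open>exp (l * (r + pi * \<i>))\<close>. The antiderivative \<open>?F\<close> is the imaginary
  part of the complex one, with denominator \<open>N\<close> the squared modulus of
  \<open>r + pi * \<i>\<close>. The endpoint terms \<open>(1 - u) * pi\<close> and
  \<open>u * pi\<close> add up to \<open>pi\<close>.\<close>

lemma integral_sin_geometric:
  assumes u: "0 < u" "u < 1"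
  shows "((\<lambda>l. sin (l * pi) * ((1 - u) powr l * u powr (1 - l))) has_integral pi * logit_weight u) {0..1}"
proof -
  define r where "r = ln (1 / u - 1)"
  have r: "r = ln (1 - u) - ln u"
  proof -
    have "1 / u - 1 = (1 - u) / u" using u by (simp add: field_simps)
    then show ?thesis using u by (simp add: r_def ln_div)
  qed
  define N where "N = pi\<^sup>2 + r\<^sup>2"
  have N: "N \<noteq> 0" by (simp add: N_def add_nonneg_eq_0_iff)
  let ?F = "\<lambda>l. u * exp (l * r) * (r * sin (l * pi) - pi * cos (l * pi)) / N"
  have "((\<lambda>l. u * exp (l * r) * sin (l * pi)) has_integral ?F 1 - ?F 0) {0..1}"
  proof (rule fundamental_theorem_of_calculus)
    fix l :: real
    have "(?F has_real_derivative (u * (exp (l * r) * r) * (r * sin (l * pi) - pi * cos (l * pi))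
        + u * exp (l * r) * (r * (cos (l * pi) * pi) - pi * (- sin (l * pi) * pi))) / N) (at l within {0..1})"
      using N by (auto intro!: derivative_eq_intros)
    also have "(u * (exp (l * r) * r) * (r * sin (l * pi) - pi * cos (l * pi))
        + u * exp (l * r) * (r * (cos (l * pi) * pi) - pi * (- sin (l * pi) * pi))) / N
        = u * exp (l * r) * sin (l * pi) * (pi\<^sup>2 + r\<^sup>2) / N"
      by (simp add: algebra_simps power2_eq_square)
    also have "\<dots> = u * exp (l * r) * sin (l * pi)"
      using N unfolding N_def by (rule nonzero_mult_div_cancel_right)
    finally show "(?F has_vector_derivative u * exp (l * r) * sin (l * pi)) (at l within {0..1})"
      by (simp add: has_real_derivative_iff_has_vector_derivative)
  qed simp
  moreover have "?F 1 - ?F 0 = pi * logit_weight u"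
  proof -
    have "exp r = (1 - u) / u" using u by (simp add: r exp_diff)
    then have "?F 1 - ?F 0 = (u * ((1 - u) / u) * pi + u * pi) / N"
      by (simp add: add_divide_distrib)
    also have "u * ((1 - u) / u) * pi + u * pi = pi"
    proof -
      have "u * ((1 - u) / u) = 1 - u" using u by simp
      then show ?thesis by (simp only:) (simp add: algebra_simps)
    qed
    finally show ?thesis using u by (simp add: logit_weight_def N_def r_def)
  qed
  moreover have "u * exp (l * r) * sin (l * pi) = sin (l * pi) * ((1 - u) powr l * u powr (1 - l))" for l
    using u by (simp add: powr_def r algebra_simps exp_add exp_diff)
  ultimately show ?thesis by simp
qed

text \<open>Integration by parts: the factor of \<open>exp (- (u * s))\<close> in the definition of \<open>F_fun\<close> is the
  derivative in \<open>u\<close> of \<open>(1 - u) powr l * u powr (1 - l)\<close>, which vanishes at both endpoints.\<close>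

lemma F_fun_eq:
  assumes l: "0 < l" "l < 1"
  shows "F_fun l s = s * integral {0..1} (\<lambda>u. (1 - u) powr l * u powr (1 - l) * exp (- (u * s)))"
proof -
  let ?h = "\<lambda>u. (1 - u) powr l * u powr (1 - l)"
  let ?k = "\<lambda>u. (1 / u - 1) powr l * (1 - l / (1 - u))"
  have cont: "continuous_on {0..1} (\<lambda>u. ?h u * exp (- (u * s)))"
    using l by (intro continuous_intros continuous_on_powr') auto
  have "((\<lambda>u. ?k u * exp (- (u * s)) - s * (?h u * exp (- (u * s)))) has_integral
      ?h 1 * exp (- (1 * s)) - ?h 0 * exp (- (0 * s))) {0..1}"
  \<comment> \<open>The exponents \<open>l\<close> and \<open>1 - l\<close> are less than 1, so the
    powers are continuous but not differentiable at their zeros; derivatives are therefore taken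
    only in the interior.\<close>
  proof (rule fundamental_theorem_of_calculus_interior)
    fix u :: real assume "u \<in> {0<..<1}"
    then have u: "0 < u" "u < 1" by auto
    have p: "(1 / u - 1) powr l = (1 - u) powr l * u powr (- l)"
    proof -
      have "1 / u - 1 = (1 - u) / u" using u by (simp add: field_simps)
      then have "(1 / u - 1) powr l = (1 - u) powr l / u powr l" using u by (simp add: powr_divide)
      then show ?thesis by (simp add: powr_minus divide_inverse)
    qed
    have q: "(1 - u) powr (l - 1) = (1 - u) powr l / (1 - u)" "u powr (1 - l) = u * u powr (- l)"
      using u by (simp_all add: powr_diff powr_minus field_simps)
    have d1: "((\<lambda>u. (1 - u) powr l) has_real_derivative - (l * (1 - u) powr (l - 1))) (at u)"
      using u by (auto intro!: derivative_eq_intros)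
    have d2: "((\<lambda>u. u powr (1 - l)) has_real_derivative (1 - l) * u powr (- l)) (at u)"
      using u by (auto intro!: derivative_eq_intros)
    have d3: "((\<lambda>u. exp (- (u * s))) has_real_derivative - s * exp (- (u * s))) (at u)"
      by (auto intro!: derivative_eq_intros)
    have "- (l * (1 - u) powr (l - 1)) * u powr (1 - l) + (1 - l) * u powr (- l) * (1 - u) powr l
        = (1 - u) powr l * u powr (- l) * (- (l * u / (1 - u)) + (1 - l))"
      unfolding q by (simp add: algebra_simps)
    also have "- (l * u / (1 - u)) + (1 - l) = 1 - l / (1 - u)"
      using u by (simp add: field_simps)
    finally have "- (l * (1 - u) powr (l - 1)) * u powr (1 - l) + (1 - l) * u powr (- l) * (1 - u) powr l = ?k u"
      unfolding p .
    with DERIV_mult[OF DERIV_mult[OF d1 d2] d3]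
    have "((\<lambda>u. ?h u * exp (- (u * s))) has_real_derivative
       ?k u * exp (- (u * s)) + (- s * exp (- (u * s))) * ?h u) (at u)"
      by simp
    then show "((\<lambda>u. ?h u * exp (- (u * s))) has_vector_derivative
       ?k u * exp (- (u * s)) - s * (?h u * exp (- (u * s)))) (at u)"
      by (simp add: has_real_derivative_iff_has_vector_derivative algebra_simps)
  qed (use cont in auto)
  moreover have "((\<lambda>u. s * (?h u * exp (- (u * s)))) has_integral
      s * integral {0..1} (\<lambda>u. ?h u * exp (- (u * s)))) {0..1}"
    by (intro has_integral_mult_right integrable_integral integrable_continuous_real cont)
  ultimately have "((\<lambda>u. (?k u * exp (- (u * s)) - s * (?h u * exp (- (u * s)))) + s * (?h u * exp (- (u * s))))
      has_integral (?h 1 * exp (- (1 * s)) - ?h 0 * exp (- (0 * s)))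
        + s * integral {0..1} (\<lambda>u. ?h u * exp (- (u * s)))) {0..1}"
    by (rule has_integral_add)
  then have "((\<lambda>u. ?k u * exp (- (u * s))) has_integral
        s * integral {0..1} (\<lambda>u. ?h u * exp (- (u * s)))) {0..1}"
    using l by simp
  then have "((\<lambda>u. ?k u * exp (- (u * s))) has_integral
        s * integral {0..1} (\<lambda>u. ?h u * exp (- (u * s)))) {0<..<1}"
    by (simp add: has_integral_Icc_iff_Ioo)
  then show ?thesis
    unfolding F_fun_def by (rule integral_unique)
qed

text \<open>By \<open>F_fun_eq\<close> a factor \<open>t = (x - y) * s\<close> leaves the inner
  integral. What remains is bounded by 1 on the unit square, so Fubini applies, and
  \<open>integral_sin_geometric\<close> evaluates the integral over \<open>l\<close> for fixed
  \<open>u\<close>. The factor \<open>s\<close> cancels the denominator in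
  \<open>repr_integrand\<close>.\<close>

lemma P_fun_eq:
  assumes "x > y" "s > 0"
  shows "P_fun x y s = pi * ((x - y) * s) * (LINT u:{0<..<1}|lborel. logit_weight u * exp (- (u * ((x - y) * s))))"
proof -
  define t where "t = (x - y) * s"
  have t: "t \<ge> 0" using assms by (simp add: t_def)
  define g where "g = (\<lambda>l u. sin (l * pi) * ((1 - u) powr l * u powr (1 - l) * exp (- (u * t))))"
  define G where "G = (\<lambda>l u. indicator {0<..<1} l * (indicator {0<..<1} u * g l u))"
  have pow_le: "a powr b \<le> 1" if "0 < a" "a < 1" "0 < b" for a b :: real
    using powr_mono2[of b a 1] that by simp
  have g_le: "\<bar>g l u\<bar> \<le> 1" if "0 < l" "l < 1" "0 < u" "u < 1" for l u
  proof -
    have "\<bar>g l u\<bar> = \<bar>sin (l * pi)\<bar> * ((1 - u) powr l * u powr (1 - l) * exp (- (u * t)))"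
      by (simp add: g_def abs_mult)
    also have "\<dots> \<le> 1 * (1 * 1 * 1)"
      using that t by (intro mult_mono pow_le) auto
    finally show ?thesis by simp
  qed
  have int1: "set_integrable lborel {0<..<1} (g l)" if "0 < l" "l < 1" for l
    by (rule set_integrable_bound[where f = "\<lambda>_. 1 :: real"])
       (use g_le that in \<open>auto simp: set_borel_measurable_def g_def set_integrable_def intro!: AE_I2\<close>)
  have int2: "set_integrable lborel {0<..<1} (\<lambda>l. g l u)" if "0 < u" "u < 1" for u
    by (rule set_integrable_bound[where f = "\<lambda>_. 1 :: real"])
       (use g_le that in \<open>auto simp: set_borel_measurable_def g_def set_integrable_def intro!: AE_I2\<close>)
  have "integrable (lborel \<Otimes>\<^sub>M lborel) (case_prod G)"
  proof (rule Bochner_Integration.integrable_bound)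
    have "integrable (lborel \<Otimes>\<^sub>M lborel) (indicator ({0<..<1::real} \<times> {0<..<1::real}) :: _ \<Rightarrow> real)"
      by (intro integrable_real_indicator) (auto simp: lborel.emeasure_pair_measure_Times)
    then show "integrable (lborel \<Otimes>\<^sub>M lborel) (indicator ({0<..<1::real} \<times> {0<..<1::real}) :: _ \<Rightarrow> real)" .
    show "case_prod G \<in> borel_measurable (lborel \<Otimes>\<^sub>M lborel)"
      unfolding G_def g_def by measurable
    show "AE p in lborel \<Otimes>\<^sub>M lborel. norm (case_prod G p) \<le> norm (indicator ({0<..<1::real} \<times> {0<..<1::real}) p :: real)"
      by (intro AE_I2) (auto simp: G_def indicator_def intro!: g_le)
  qed
  note fub = lborel_pair.Fubini_integral[OF this] lborel_pair.integrable_fst[OF this]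
  have "P_fun x y s = integral {0<..<1} (\<lambda>l. t * (LINT u:{0<..<1}|lborel. g l u))"
    unfolding P_fun_def t_def[symmetric]
  proof (rule integral_cong)
    fix l :: real assume "l \<in> {0<..<1}"
    then have l: "0 < l" "l < 1" by auto
    have "(LINT u:{0<..<1}|lborel. g l u) = integral {0<..<1} (g l)"
      by (rule set_borel_integral_eq_integral(2)[OF int1[OF l]])
    also have "\<dots> = integral {0..1} (g l)"
      by (simp add: integral_open_interval_real)
    also have "\<dots> = sin (l * pi) * integral {0..1} (\<lambda>u. (1 - u) powr l * u powr (1 - l) * exp (- (u * t)))"
      unfolding g_def by simp
    finally show "sin (l * pi) * F_fun l t = t * (LINT u:{0<..<1}|lborel. g l u)"
      by (simp add: F_fun_eq[OF l])
  qed
  also have "\<dots> = t * integral {0<..<1} (\<lambda>l. LINT u:{0<..<1}|lborel. g l u)"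
    by simp
  also have "integral {0<..<1} (\<lambda>l. LINT u:{0<..<1}|lborel. g l u) = (LINT l:{0<..<1}|lborel. LINT u:{0<..<1}|lborel. g l u)"
    using fub(2) by (intro set_borel_integral_eq_integral(2)[symmetric])
      (simp add: G_def set_integrable_def set_lebesgue_integral_def)
  also have "\<dots> = (LINT l|lborel. LINT u|lborel. G l u)"
    by (simp add: G_def set_lebesgue_integral_def)
  also have "\<dots> = (LINT u|lborel. LINT l|lborel. G l u)"
    by (rule fub(1)[symmetric])
  also have "\<dots> = (LINT u:{0<..<1}|lborel. pi * (logit_weight u * exp (- (u * t))))"
    unfolding set_lebesgue_integral_def
  proof (rule Bochner_Integration.integral_cong[OF refl])
    fix u :: real
    show "(LINT l|lborel. G l u) = indicat_real {0<..<1} u *\<^sub>R (pi * (logit_weight u * exp (- (u * t))))"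
    proof (cases "u \<in> {0<..<1}")
      case True
      then have u: "0 < u" "u < 1" by auto
      have "(LINT l|lborel. G l u) = (LINT l:{0<..<1}|lborel. g l u)"
        using True by (simp add: G_def set_lebesgue_integral_def)
      also have "\<dots> = integral {0<..<1} (\<lambda>l. g l u)"
        by (rule set_borel_integral_eq_integral(2)[OF int2[OF u]])
      also have "\<dots> = integral {0..1} (\<lambda>l. g l u)"
        by (simp add: integral_open_interval_real)
      also have "\<dots> = pi * logit_weight u * exp (- (u * t))"
        using has_integral_mult_left[OF integral_sin_geometric[OF u], of "exp (- (u * t))"]
        by (intro integral_unique) (simp add: g_def mult.assoc)
      finally show ?thesis using True by simp
    qed (simp add: G_def)
  qed
  finally show ?thesis by (simp add: t_def mult_ac)
qed

section \<open>Laplace integrals and the interchange of integration in \<open>s\<close> and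
  \<open>u\<close>\<close>

lemma exponential_integral_real:
  fixes r :: real
  assumes "r > 0"
  shows "set_integrable lborel {0<..} (\<lambda>s. exp (- (s * r)))"
    and "(LINT s:{0<..}|lborel. exp (- (s * r))) = 1 / r"
proof -
  let ?F = "\<lambda>s. - exp (- (s * r)) / r"
  have ei: "einterval 0 \<infinity> = {0::real<..}"
    by (auto simp: einterval_def)
  have lims: "((?F \<circ> real_of_ereal) \<longlongrightarrow> - 1 / r) (at_right 0)" "((?F \<circ> real_of_ereal) \<longlongrightarrow> 0) (at_left \<infinity>)"
  proof -
    have "(?F \<longlongrightarrow> - exp (- (0 * r)) / r) (at_right 0)" using assms by (intro tendsto_intros) auto
    then show "((?F \<circ> real_of_ereal) \<longlongrightarrow> - 1 / r) (at_right 0)"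
      by (simp add: zero_ereal_def ereal_tendsto_simps1)
    have "(?F \<longlongrightarrow> 0) at_top" using assms by real_asymp
    then show "((?F \<circ> real_of_ereal) \<longlongrightarrow> 0) (at_left \<infinity>)"
      by (simp add: ereal_tendsto_simps1)
  qed
  have der: "(?F has_real_derivative exp (- (s * r))) (at s)" for s
    using assms by (auto intro!: derivative_eq_intros)
  have "set_integrable lborel (einterval 0 \<infinity>) (\<lambda>s. exp (- (s * r)))"
    by (rule interval_integral_FTC_nonneg(1)[OF _ der _ _ lims]) auto
  then show "set_integrable lborel {0<..} (\<lambda>s. exp (- (s * r)))" unfolding ei .
  have "(LBINT s=0..\<infinity>. exp (- (s * r))) = 0 - (- 1 / r)"
    by (rule interval_integral_FTC_nonneg(2)[OF _ der _ _ lims]) auto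
  then show "(LINT s:{0<..}|lborel. exp (- (s * r))) = 1 / r"
    by (simp add: interval_lebesgue_integral_0_infty)
qed

lemma exponential_integral_complex:
  fixes A :: complex
  assumes A: "Re A > 0"
  shows "set_integrable lborel {0<..} (\<lambda>s. exp (- (of_real s * A)))"
    and "(LINT s:{0<..}|lborel. exp (- (of_real s * A))) = 1 / A"
proof -
  have A0: "A \<noteq> 0" using A by auto
  show int: "set_integrable lborel {0<..} (\<lambda>s. exp (- (of_real s * A)))"
    by (rule set_integrable_bound[OF exponential_integral_real(1)[OF A]])
       (auto simp: set_borel_measurable_def)
  let ?F = "\<lambda>s::real. - exp (- (of_real s * A)) / A"
  have ei: "einterval 0 \<infinity> = {0::real<..}"
    by (auto simp: einterval_def)
  have "(LBINT s=0..\<infinity>. exp (- (of_real s * A))) = 0 - (- 1 / A)"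
  proof (rule interval_integral_FTC_integrable)
    fix s :: real
    have "((\<lambda>w. - exp (- (w * A)) / A) has_field_derivative exp (- (of_real s * A))) (at (of_real s))"
      using A0 by (auto intro!: derivative_eq_intros)
    from has_vector_derivative_real_field[OF this]
    show "(?F has_vector_derivative exp (- (of_real s * A))) (at s)" by simp
    have "(?F \<longlongrightarrow> - exp (- (of_real 0 * A)) / A) (at_right 0)" using A0 by (intro tendsto_intros) auto
    then show "((?F \<circ> real_of_ereal) \<longlongrightarrow> - 1 / A) (at_right 0)"
      by (simp add: zero_ereal_def ereal_tendsto_simps1)
    have "((\<lambda>s. exp (- (s * Re A)) / norm A) \<longlongrightarrow> 0) at_top"
    proof -
      have "norm A > 0" using A0 by simp
      then show ?thesis using A by real_asymp
    qed
    then have "(?F \<longlongrightarrow> 0) at_top"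
      by (rule Lim_null_comparison[rotated]) (simp add: norm_divide)
    then show "((?F \<circ> real_of_ereal) \<longlongrightarrow> 0) (at_left \<infinity>)"
      by (simp add: ereal_tendsto_simps1)
  qed (use int in \<open>auto simp: ei\<close>)
  then show "(LINT s:{0<..}|lborel. exp (- (of_real s * A))) = 1 / A"
    by (simp add: interval_lebesgue_integral_0_infty)
qed

text \<open>By \<open>P_fun_eq\<close> the integrand is itself an integral over \<open>u\<close>;
  interchanging the two integrals leaves Laplace integrals of exponentials in \<open>s\<close>. The
  majorant \<open>2 * logit_weight u * exp (- (s * (u * d)))\<close> integrates over
  \<open>s\<close> to \<open>2 / d * (logit_weight u / u)\<close>, which is integrable by
  \<open>set_integrable_logit_weight_over\<close>. The decay in \<open>s\<close> comes from
  \<open>u * d\<close> alone, so the line \<open>Re z = - y\<close> is included.\<close>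

lemma repr_integrand_has_integral:
  assumes xy: "x > y" "y > 0"
    and z: "Re z \<ge> - y" "z \<noteq> - of_real y"
  shows "(repr_integrand x y z has_integral
     of_real (pi * (x - y)) * (LINT u:{0<..<1}|lborel. of_real (logit_weight u) *
        (1 / (of_real (u * (x - y)) + of_real y) - 1 / (of_real (u * (x - y)) + (of_real y + z))))) {0<..}"
proof -
  define d where "d = x - y"
  define W where "W = of_real y + z"
  have d: "d > 0" and W: "Re W \<ge> 0" using xy z by (auto simp: d_def W_def)
  \<comment> \<open>This is the factor \<open>exp (- (s * y)) * (1 - exp (- (s * z)))\<close> of the
    integrand, multiplied out. Each term has norm at most 1 for \<open>s > 0\<close>, since
    \<open>y > 0\<close> and \<open>Re W \<ge> 0\<close>.\<close>
  define B where "B = (\<lambda>s::real. exp (- (of_real s * of_real y)) - exp (- (of_real s * W)))"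
  have B: "norm (B s) \<le> 2" if "s > 0" for s
  proof -
    have "norm (B s) \<le> exp (- (s * y)) + exp (- (s * Re W))"
      unfolding B_def by (rule order.trans[OF norm_triangle_ineq4]) simp
    moreover have "exp (- (s * y)) \<le> 1" "exp (- (s * Re W)) \<le> 1" using that xy W by auto
    ultimately show ?thesis by linarith
  qed
  define H where "H = (\<lambda>u s. indicat_real {0<..<1} u *\<^sub>R (indicat_real {0<..} s *\<^sub>R
      (of_real (logit_weight u * exp (- (u * (d * s)))) * B s)))"
  have meas [measurable]: "case_prod H \<in> borel_measurable (lborel \<Otimes>\<^sub>M lborel)"
    unfolding H_def B_def by measurable
  have bound_int: "integrable lborel (\<lambda>s. indicat_real {0<..} s * (2 * (logit_weight u * exp (- (s * (u * d))))))"
    "(LINT s|lborel. indicat_real {0<..} s * (2 * (logit_weight u * exp (- (s * (u * d)))))) = 2 / d * (logit_weight u / u)"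
    if "0 < u" for u
  proof -
    have ud: "u * d > 0" using that d by simp
    have eq: "(\<lambda>s. indicat_real {0<..} s * (2 * (logit_weight u * exp (- (s * (u * d))))))
        = (\<lambda>s. 2 * logit_weight u * (indicat_real {0<..} s *\<^sub>R exp (- (s * (u * d)))))"
      by (auto simp: fun_eq_iff)
    show "integrable lborel (\<lambda>s. indicat_real {0<..} s * (2 * (logit_weight u * exp (- (s * (u * d))))))"
      using exponential_integral_real(1)[OF ud] unfolding eq set_integrable_def by simp
    show "(LINT s|lborel. indicat_real {0<..} s * (2 * (logit_weight u * exp (- (s * (u * d)))))) = 2 / d * (logit_weight u / u)"
      using exponential_integral_real(2)[OF ud] unfolding eq set_lebesgue_integral_def by simp
  qed
  have H_bound: "norm (H u s) \<le> indicat_real {0<..} s * (2 * (logit_weight u * exp (- (s * (u * d)))))" for u s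
  proof (cases "0 < s \<and> u \<in> {0<..<1}")
    case True
    then have "norm (H u s) = logit_weight u * exp (- (s * (u * d))) * norm (B s)"
      by (simp add: H_def norm_mult logit_weight_nonneg mult_ac)
    also have "\<dots> \<le> logit_weight u * exp (- (s * (u * d))) * 2"
      using True by (intro mult_left_mono B) (auto simp: logit_weight_nonneg)
    finally show ?thesis using True by simp
  next
    case False
    then show ?thesis by (auto simp: H_def logit_weight_nonneg)
  qed
  have H_int: "integrable lborel (H u)" for u
  proof (cases "u \<in> {0<..<1}")
    case True
    show ?thesis
    proof (rule Bochner_Integration.integrable_bound[OF bound_int(1)])
      show "H u \<in> borel_measurable lborel" unfolding H_def B_def by measurable
      show "AE s in lborel. norm (H u s) \<le> norm (indicat_real {0<..} s * (2 * (logit_weight u * exp (- (s * (u * d))))))"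
        by (intro AE_I2 order.trans[OF H_bound]) simp
    qed (use True in auto)
  qed (simp add: H_def)
  have "integrable (lborel \<Otimes>\<^sub>M lborel) (case_prod H)"
  proof (rule lborel_pair.Fubini_integrable[OF meas])
    show "integrable lborel (\<lambda>u. LINT s|lborel. norm (case (u, s) of (u, s) \<Rightarrow> H u s))"
    proof (rule Bochner_Integration.integrable_bound)
      show "integrable lborel (\<lambda>u. indicat_real {0<..<1} u *\<^sub>R (2 / d * (logit_weight u / u)))"
        using set_integrable_mult_right[of "2 / d" lborel "{0<..<1}" "\<lambda>u. logit_weight u / u"]
          set_integrable_logit_weight_over
        unfolding set_integrable_def by simp
      show "(\<lambda>u. LINT s|lborel. norm (case (u, s) of (u, s) \<Rightarrow> H u s)) \<in> borel_measurable lborel"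
        by measurable
      show "AE u in lborel. norm (LINT s|lborel. norm (case (u, s) of (u, s) \<Rightarrow> H u s))
          \<le> norm (indicat_real {0<..<1} u *\<^sub>R (2 / d * (logit_weight u / u)))"
      proof (intro AE_I2)
        fix u :: real
        show "norm (LINT s|lborel. norm (case (u, s) of (u, s) \<Rightarrow> H u s))
          \<le> norm (indicat_real {0<..<1} u *\<^sub>R (2 / d * (logit_weight u / u)))"
        proof (cases "u \<in> {0<..<1}")
          case True
          have "(LINT s|lborel. norm (H u s)) \<le> 2 / d * (logit_weight u / u)"
          proof -
            have u: "0 < u" using True by simp
            show ?thesis
              unfolding bound_int(2)[OF u, symmetric]
              by (intro integral_mono H_bound integrable_norm H_int bound_int(1)[OF u])
          qed
          moreover have "(LINT s|lborel. norm (H u s)) \<ge> 0" by simp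
          ultimately show ?thesis using True d by (simp add: logit_weight_nonneg abs_mult)
        qed (simp add: H_def)
      qed
    qed
  qed (use H_int in auto)
  note fub = lborel_pair.Fubini_integral[OF this] lborel_pair.integrable_snd[OF this]
  have inner_s: "(LINT s|lborel. H u s) = indicat_real {0<..<1} u *\<^sub>R (of_real (logit_weight u) *
      (1 / (of_real (u * d) + of_real y) - 1 / (of_real (u * d) + W)))" for u
  proof (cases "u \<in> {0<..<1}")
    case True
    then have "u * d > 0" using d by simp
    then have A: "Re (of_real (u * d) + of_real y) > 0" "Re (of_real (u * d) + W) > 0"
      using xy W by auto
    have "(LINT s|lborel. H u s) = (LINT s:{0<..}|lborel. of_real (logit_weight u) *
      (exp (- (of_real s * (of_real (u * d) + of_real y))) - exp (- (of_real s * (of_real (u * d) + W)))))"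
      unfolding set_lebesgue_integral_def
    proof (rule Bochner_Integration.integral_cong[OF refl])
      fix s :: real
      have "of_real (exp (- (u * (d * s)))) * B s = exp (- (of_real s * (of_real (u * d) + of_real y))) - exp (- (of_real s * (of_real (u * d) + W)))"
        unfolding B_def right_diff_distrib by (simp add: exp_of_real[symmetric] exp_add[symmetric] algebra_simps)
      then show "H u s = indicat_real {0<..} s *\<^sub>R (of_real (logit_weight u) *
         (exp (- (of_real s * (of_real (u * d) + of_real y))) - exp (- (of_real s * (of_real (u * d) + W)))))"
        using True by (simp add: H_def mult.assoc)
    qed
    also have "\<dots> = of_real (logit_weight u) * (1 / (of_real (u * d) + of_real y) - 1 / (of_real (u * d) + W))"
      using exponential_integral_complex[OF A(1)] exponential_integral_complex[OF A(2)]
      by (simp add: set_integral_diff)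
    finally show ?thesis using True by simp
  qed (simp add: H_def)
  have inner_u: "(LINT u|lborel. H u s) = indicat_real {0<..} s *\<^sub>R (repr_integrand x y z s / of_real (pi * d))" for s
  proof (cases "s > 0")
    case True
    have "(LINT u|lborel. H u s) = (LINT u|lborel. of_real (indicat_real {0<..<1} u *\<^sub>R (logit_weight u * exp (- (u * (d * s))))) * B s)"
      using True by (intro Bochner_Integration.integral_cong[OF refl]) (simp add: H_def scaleR_conv_of_real)
    also have "\<dots> = of_real (LINT u:{0<..<1}|lborel. logit_weight u * exp (- (u * (d * s)))) * B s"
      unfolding integral_mult_left_zero integral_complex_of_real set_lebesgue_integral_def ..
    also have "\<dots> = repr_integrand x y z s / of_real (pi * d)"
    proof -
      have "B s = exp (- (of_real s * of_real y)) * (1 - exp (- (of_real s * z)))"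
        by (simp add: B_def W_def algebra_simps exp_add[symmetric])
      moreover have "P_fun x y s / s = pi * d * (LINT u:{0<..<1}|lborel. logit_weight u * exp (- (u * (d * s))))"
        using P_fun_eq[OF xy(1) True] True by (simp add: d_def)
      ultimately show ?thesis
        using d unfolding repr_integrand_def by (simp add: exp_of_real[symmetric])
    qed
    finally show ?thesis using True by simp
  qed (simp add: H_def)
  \<comment> \<open>Integrability in \<open>s\<close> comes from Fubini as well: up to a constant
    the integrand is the marginal of \<open>H\<close> after integrating out
    \<open>u\<close>.\<close>
  have "integrable lborel (\<lambda>s. indicat_real {0<..} s *\<^sub>R (repr_integrand x y z s / of_real (pi * d)))"
    using fub(2) unfolding inner_u .
  then have si: "set_integrable lborel {0<..} (repr_integrand x y z)"
    using d set_integrable_mult_right[of "of_real (pi * d)" lborel "{0<..}" "\<lambda>s. repr_integrand x y z s / of_real (pi * d)"]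
    unfolding set_integrable_def by (simp del: of_real_mult)
  have "(LINT s:{0<..}|lborel. repr_integrand x y z s) = of_real (pi * d) * (LINT s:{0<..}|lborel. repr_integrand x y z s / of_real (pi * d))"
    using d by (simp del: of_real_mult)
  also have "(LINT s:{0<..}|lborel. repr_integrand x y z s / of_real (pi * d)) = (LINT u:{0<..<1}|lborel. of_real (logit_weight u) *
      (1 / (of_real (u * d) + of_real y) - 1 / (of_real (u * d) + W)))"
    using fub(1) unfolding inner_u inner_s set_lebesgue_integral_def .
  finally show ?thesis
    using set_borel_integral_eq_integral[OF si] by (simp add: has_integral_iff d_def W_def)
qed

section \<open>The logarithmic mean on the cut plane\<close>

text \<open>Dividing both arguments by the positive number \<open>x - y\<close> changes both
  logarithms by the same real constant, which cancels in the difference. The rescaled arguments are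
  \<open>w\<close> and \<open>1 + w\<close>, as \<open>inverse_Ln_diff\<close> expects.\<close>

lemma cut_plane_shift:
  assumes "x > y" "z \<in> cut_plane y"
  shows "(of_real y + z) / of_real (x - y) \<notin> \<real>\<^sub>\<le>\<^sub>0"
    and "of_real y + z \<notin> \<real>\<^sub>\<le>\<^sub>0" "of_real x + z \<notin> \<real>\<^sub>\<le>\<^sub>0"
    and "Ln (of_real x + z) - Ln (of_real y + z)
      = Ln (1 + (of_real y + z) / of_real (x - y)) - Ln ((of_real y + z) / of_real (x - y))"
proof -
  define w where "w = (of_real y + z) / of_real (x - y)"
  have z: "Im z \<noteq> 0 \<or> Re z > - y"
  proof (rule ccontr)
    assume "\<not> ?thesis"
    then have "z = of_real (Re z)" "Re z \<in> {..- y}" by (auto simp: complex_eq_iff)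
    with assms(2) show False unfolding cut_plane_def by blast
  qed
  then show yz: "of_real y + z \<notin> \<real>\<^sub>\<le>\<^sub>0" and xz: "of_real x + z \<notin> \<real>\<^sub>\<le>\<^sub>0"
    using assms(1) by (auto simp: complex_nonpos_Reals_iff)
  have d: "x - y > 0" using assms(1) by simp
  have "Re w = (y + Re z) / (x - y)" "Im w = Im z / (x - y)"
    unfolding w_def by (simp_all only: Re_divide_of_real Im_divide_of_real plus_complex.sel Re_complex_of_real Im_complex_of_real add_0_left)
  then show "(of_real y + z) / of_real (x - y) \<notin> \<real>\<^sub>\<le>\<^sub>0"
    using z d unfolding w_def[symmetric] by (auto simp: complex_nonpos_Reals_iff divide_le_0_iff)
  have "complex_of_real (x - y) \<noteq> 0" using d by simp
  then have e1: "of_real y + z = of_real (x - y) * w"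
    unfolding w_def times_divide_eq_right by (rule nonzero_mult_div_cancel_left[symmetric])
  moreover have "of_real x + z = of_real (x - y) * (1 + w)"
    unfolding distrib_left e1[symmetric] by simp
  ultimately have e: "of_real y + z = of_real (x - y) * w" "of_real x + z = of_real (x - y) * (1 + w)" .
  have "w \<noteq> 0" "1 + w \<noteq> 0" using e yz xz by auto
  then show "Ln (of_real x + z) - Ln (of_real y + z)
      = Ln (1 + (of_real y + z) / of_real (x - y)) - Ln ((of_real y + z) / of_real (x - y))"
    unfolding w_def[symmetric] unfolding e using d by (simp add: Ln_times_of_real del: of_real_diff)
qed

lemma clog_mean_of_real:
  assumes "a > 0" "b > 0"
  shows "clog_mean (of_real a) (of_real b) = of_real (log_mean a b)"
proof -
  have "log_mean a b = (a - b) / (ln a - ln b)"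
    unfolding log_mean_def by (metis minus_diff_eq minus_divide_divide)
  then show ?thesis using assms by (simp add: clog_mean_def Ln_of_real)
qed

lemma clog_mean_eq:
  assumes "x > y" "z \<in> cut_plane y"
  defines "d \<equiv> x - y"
  defines "w \<equiv> (of_real y + z) / of_real d"
  shows "clog_mean (of_real x + z) (of_real y + z) =
    of_real d * (w + 1 / 2 - integral {0..1} (\<lambda>u. of_real (logit_weight u) / (w + of_real u)))"
proof -
  have "clog_mean (of_real x + z) (of_real y + z) = of_real d * (1 / (Ln (1 + w) - Ln w))"
    unfolding clog_mean_def cut_plane_shift(4)[OF assms(1,2)] d_def w_def by simp
  then show ?thesis
    using inverse_Ln_diff[OF cut_plane_shift(1)[OF assms(1,2)]] by (simp only: d_def w_def)
qed

text \<open>This is the form for differentiation: after multiplying through by \<open>x - y\<close>,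
  the integrand depends on \<open>t\<close> only through the linear denominator
  \<open>y + t + (x - y) * u\<close>.\<close>

lemma log_mean_eq:
  assumes "x > y" "t > - y"
  shows "log_mean (x + t) (y + t) = y + t + (x - y) / 2
     - (x - y)\<^sup>2 * integral {0..1} (\<lambda>u. logit_weight u / (y + t + (x - y) * u))"
proof -
  define d where "d = x - y"
  define w where "w = (y + t) / d"
  have d: "d > 0" and w: "w > 0" using assms by (auto simp: d_def w_def)
  have z: "complex_of_real t \<in> cut_plane y" using assms by (auto simp: cut_plane_def)
  have cont: "continuous_on {0..1} (\<lambda>u. logit_weight u / (w + u))"
    using w by (intro continuous_intros continuous_on_logit_weight) auto
  have cw: "(of_real y + complex_of_real t) / of_real (x - y) = of_real w" by (simp add: w_def d_def)
  have "complex_of_real (log_mean (x + t) (y + t)) = clog_mean (of_real x + of_real t) (of_real y + of_real t)"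
    using clog_mean_of_real[of "x + t" "y + t"] assms by simp
  also have "\<dots> = of_real d * (of_real w + 1 / 2 - integral {0..1} (\<lambda>u. of_real (logit_weight u) / (of_real w + of_real u)))"
    using clog_mean_eq[OF assms(1) z] unfolding cw by (simp only: d_def)
  also have "integral {0..1} (\<lambda>u. of_real (logit_weight u) / (of_real w + of_real u)) = complex_of_real (integral {0..1} (\<lambda>u. logit_weight u / (w + u)))"
    using integral_linear[OF integrable_continuous_real[OF cont] bounded_linear_of_real[where 'a = complex]]
    by (simp add: o_def)
  also have "of_real d * (of_real w + 1 / 2 - complex_of_real (integral {0..1} (\<lambda>u. logit_weight u / (w + u))))
     = of_real (d * (w + 1 / 2 - integral {0..1} (\<lambda>u. logit_weight u / (w + u))))"
    by simp
  finally have "log_mean (x + t) (y + t) = d * (w + 1 / 2 - integral {0..1} (\<lambda>u. logit_weight u / (w + u)))"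
    by (simp only: of_real_eq_iff)
  also have "integral {0..1} (\<lambda>u. logit_weight u / (w + u)) = integral {0..1} (\<lambda>u. d * (logit_weight u / (y + t + d * u)))"
  proof (rule integral_cong)
    fix u :: real
    have "w + u = (y + t + d * u) / d" using d by (simp add: w_def add_divide_distrib)
    then show "logit_weight u / (w + u) = d * (logit_weight u / (y + t + d * u))" by simp
  qed
  also have "\<dots> = d * integral {0..1} (\<lambda>u. logit_weight u / (y + t + d * u))"
    by (rule Henstock_Kurzweil_Integration.integral_mult_right)
  finally have "log_mean (x + t) (y + t) = d * (w + 1 / 2 - d * integral {0..1} (\<lambda>u. logit_weight u / (y + t + d * u)))" .
  moreover have "d * w = y + t" using d by (simp add: w_def)
  ultimately show ?thesis
    unfolding d_def[symmetric] by (simp add: right_diff_distrib distrib_left power2_eq_square mult.assoc)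
qed

text \<open>The Stieltjes formula is applied at \<open>z\<close> and at 0, which lies in the cut
  plane because \<open>y > 0\<close>. In the difference the constants 1/2 cancel, the linear terms
  leave \<open>z\<close>, and the two Stieltjes integrals form the expression in
  \<open>repr_integrand_has_integral\<close>.\<close>

lemma clog_mean_representation:
  assumes xy: "x > y" "y > 0" and z: "z \<in> cut_plane y" "Re z \<ge> - y"
  shows "repr_integrand x y z integrable_on {0<..}"
    and "clog_mean (of_real x + z) (of_real y + z) = of_real (log_mean x y) + z
          + of_real ((x - y) / pi) * integral {0<..} (repr_integrand x y z)"
proof -
  define d where "d = x - y"
  have d: "d > 0" using xy by (simp add: d_def)
  define I where "I = (\<lambda>w. integral {0..1} (\<lambda>u. of_real (logit_weight u) / (w + complex_of_real u)))"
  have z0: "0 \<in> cut_plane y" using xy by (auto simp: cut_plane_def)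
  have zy: "z \<noteq> - of_real y" using z(1) unfolding cut_plane_def
    by (metis Compl_iff atMost_iff image_eqI of_real_minus order_refl)
  note rep = repr_integrand_has_integral[OF xy z(2) zy]
  then show "repr_integrand x y z integrable_on {0<..}" by (rule has_integral_integrable)
  \<comment> \<open>Rescaling by \<open>u * d + W = d * (W / d + u)\<close> matches the two
    normalisations of the Stieltjes integral. It is needed for \<open>W = y\<close> and for
    \<open>W = y + z\<close>.\<close>
  have S: "set_integrable lborel {0<..<1} (\<lambda>u. of_real (logit_weight u) * (1 / (of_real (u * d) + W)))"
      "(LINT u:{0<..<1}|lborel. of_real (logit_weight u) * (1 / (of_real (u * d) + W))) = I (W / of_real d) / of_real d"
    if W: "W / of_real d \<notin> \<real>\<^sub>\<le>\<^sub>0" for W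
  proof -
    define w where "w = W / of_real d"
    have wu: "w + of_real u \<noteq> 0" if "u \<ge> 0" for u
      using W that unfolding w_def[symmetric] by (auto simp: complex_nonpos_Reals_iff complex_eq_iff)
    have eq: "of_real (logit_weight u) * (1 / (of_real (u * d) + W)) = of_real (logit_weight u) / (w + of_real u) / of_real d" for u
    proof -
      have "of_real (u * d) + W = (w + of_real u) * of_real d" using d by (simp add: w_def algebra_simps)
      then show ?thesis by simp
    qed
    have c: "continuous_on {0..1} (\<lambda>u. of_real (logit_weight u) / (w + of_real u) / of_real d)"
      using wu d by (intro continuous_intros continuous_on_logit_weight) auto
    show si: "set_integrable lborel {0<..<1} (\<lambda>u. of_real (logit_weight u) * (1 / (of_real (u * d) + W)))"
      unfolding eq by (rule set_integrable_subset[OF borel_integrable_atLeastAtMost'[OF c]]) auto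
    show "(LINT u:{0<..<1}|lborel. of_real (logit_weight u) * (1 / (of_real (u * d) + W))) = I (W / of_real d) / of_real d"
      unfolding set_borel_integral_eq_integral(2)[OF si]
      unfolding eq I_def w_def[symmetric] by (simp only: integral_open_interval_real integral_divide)
  qed
  have W: "complex_of_real y / of_real d \<notin> \<real>\<^sub>\<le>\<^sub>0" "(of_real y + z) / of_real d \<notin> \<real>\<^sub>\<le>\<^sub>0"
    using cut_plane_shift(1)[OF xy(1) z0] cut_plane_shift(1)[OF xy(1) z(1)] by (simp_all only: d_def add_0_right not_False_eq_True)
  have "integral {0<..} (repr_integrand x y z) = of_real (pi * d) * (LINT u:{0<..<1}|lborel.
      of_real (logit_weight u) * (1 / (of_real (u * d) + of_real y) - 1 / (of_real (u * d) + (of_real y + z))))"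
    using integral_unique[OF rep] unfolding d_def .
  also have "\<dots> = of_real (pi * d) * (LINT u:{0<..<1}|lborel.
      of_real (logit_weight u) * (1 / (of_real (u * d) + of_real y)) - of_real (logit_weight u) * (1 / (of_real (u * d) + (of_real y + z))))"
    unfolding right_diff_distrib[of "complex_of_real (logit_weight u)" for u] ..
  also have "\<dots> = of_real (pi * d) * (I (of_real y / of_real d) / of_real d - I ((of_real y + z) / of_real d) / of_real d)"
    unfolding set_integral_diff(2)[OF S(1)[OF W(1)] S(1)[OF W(2)]] S(2)[OF W(1)] S(2)[OF W(2)] ..
  also have "\<dots> = of_real pi * (I (of_real y / of_real d) - I ((of_real y + z) / of_real d))"
    using d by (simp add: diff_divide_distrib[symmetric])
  finally have int: "of_real (d / pi) * integral {0<..} (repr_integrand x y z) = of_real d * (I (of_real y / of_real d) - I ((of_real y + z) / of_real d))"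
    by simp
  have "of_real (log_mean x y) = of_real d * (of_real y / of_real d + 1 / 2 - I (of_real y / of_real d))"
    using clog_mean_eq[OF xy(1) z0] clog_mean_of_real[of x y] xy by (simp only: I_def d_def add_0_right)
  moreover have "clog_mean (of_real x + z) (of_real y + z) = of_real d * ((of_real y + z) / of_real d + 1 / 2 - I ((of_real y + z) / of_real d))"
    using clog_mean_eq[OF xy(1) z(1)] by (simp only: I_def d_def)
  moreover have "of_real d * ((of_real y + z) / of_real d) = of_real d * (of_real y / of_real d) + z"
    using d by simp
  ultimately show "clog_mean (of_real x + z) (of_real y + z) = of_real (log_mean x y) + z
          + of_real ((x - y) / pi) * integral {0<..} (repr_integrand x y z)"
    unfolding d_def[symmetric] int by (simp only: right_diff_distrib distrib_left) simp
qed

section \<open>The Bernstein property\<close>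

text \<open>By \<open>log_mean_eq\<close> the function is affine of slope 1 minus a positive
  multiple of the Stieltjes transform \<open>J 0\<close>. The derivatives of \<open>J 0\<close> are
  \<open>(- 1) ^ n * fact n * J n\<close> with \<open>J n\<close> nonnegative, so the subtraction
  gives the derivatives of the mean the required alternating signs. Nonnegativity is read off the
  quotient defining the mean.\<close>

lemma bernstein_log_mean:
  assumes xy: "x > y"
  shows "bernstein_on (\<lambda>t. log_mean (x + t) (y + t)) {- y<..}"
proof -
  define d where "d = x - y"
  have d: "d > 0" using xy by (simp add: d_def)
  define J where "J = (\<lambda>n t. integral {0..1} (\<lambda>u. logit_weight u / (y + t + d * u) ^ Suc n))"
  have pos: "y + t + d * u > 0" if "t > - y" "u \<ge> 0" for t u
    using that d add_pos_nonneg[of "y + t" "d * u"] by simp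
  have J_integrable: "(\<lambda>u. logit_weight u / (y + t + d * u) ^ Suc n) integrable_on {0..1}" if "t > - y" for n t
    using pos[OF that]
    by (intro integrable_continuous_real continuous_intros continuous_on_logit_weight) fastforce
  have J_nonneg: "J n t \<ge> 0" if "t > - y" for n t
    unfolding J_def
  proof (rule Henstock_Kurzweil_Integration.integral_nonneg[OF J_integrable[OF that]])
    fix u :: real assume "u \<in> {0..1}"
    then have "y + t + d * u > 0" using pos[OF that] by simp
    then show "logit_weight u / (y + t + d * u) ^ Suc n \<ge> 0"
      by (intro divide_nonneg_nonneg logit_weight_nonneg zero_le_power less_imp_le)
  qed
  have J_deriv: "(J n has_real_derivative - (real (Suc n) * J (Suc n) t)) (at t within {- y<..})"
    if t: "t > - y" for n t
  proof -
    let ?f' = "\<lambda>t u. - (real (Suc n) * (logit_weight u / (y + t + d * u) ^ Suc (Suc n)))"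
    have "((\<lambda>t. integral (cbox 0 1) (\<lambda>u. logit_weight u / (y + t + d * u) ^ Suc n))
        has_field_derivative integral (cbox 0 1) (?f' t)) (at t within {- y<..})"
    proof (rule leibniz_rule_field_derivative)
      fix s u :: real assume s: "s \<in> {- y<..}" and u: "u \<in> cbox 0 1"
      then have p: "y + s + d * u \<noteq> 0" using pos[of s u] by auto
      have "((\<lambda>s. (y + s + d * u) ^ Suc n) has_real_derivative real (Suc n) * (y + s + d * u) ^ n) (at s within {- y<..})"
        by (auto intro!: derivative_eq_intros simp del: power_Suc)
      from DERIV_cmult[OF DERIV_inverse_fun[OF this], of "logit_weight u"] p
      show "((\<lambda>s. logit_weight u / (y + s + d * u) ^ Suc n) has_real_derivative ?f' s u) (at s within {- y<..})"
        by (simp add: divide_inverse mult_ac)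
    next
      fix s assume s: "s \<in> {- y<..}"
      then show "(\<lambda>u. logit_weight u / (y + s + d * u) ^ Suc n) integrable_on cbox 0 1"
        using J_integrable[of s n] by simp
    next
      have "continuous_on ({- y<..} \<times> {0..1}) (\<lambda>p. logit_weight (snd p))"
        by (rule continuous_on_compose2[OF continuous_on_logit_weight]) (auto intro!: continuous_intros)
      then have "continuous_on ({- y<..} \<times> {0..1}) (\<lambda>p. ?f' (fst p) (snd p))"
        using pos by (intro continuous_intros) fastforce+
      then show "continuous_on ({- y<..} \<times> cbox 0 1) (\<lambda>(t, u). ?f' t u)"
        by (simp add: split_beta)
    qed (use t in auto)
    moreover have "integral (cbox 0 1) (?f' t) = - (real (Suc n) * J (Suc n) t)"
      unfolding J_def by (simp only: box_real integral_neg Henstock_Kurzweil_Integration.integral_mult_right)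
    ultimately show ?thesis by (simp only: J_def box_real)
  qed
  define E where "E = (\<lambda>n t. (- 1) ^ n * fact n * J n t)"
  have E_deriv: "(E n has_real_derivative E (Suc n) t) (at t within {- y<..})" if "t > - y" for n t
    using DERIV_cmult[OF J_deriv[OF that], of "(- 1) ^ n * fact n" n] by (simp add: E_def algebra_simps)
  \<comment> \<open>All derivatives in closed form: the affine part contributes its value at order
    0, its slope at order 1 and nothing beyond.\<close>
  define D where "D = (\<lambda>n t. (if n = 0 then y + t + d / 2 else if n = 1 then 1 else 0) - d\<^sup>2 * E n t)"
  have D_deriv: "(D n has_real_derivative D (Suc n) t) (at t within {- y<..})" if "t > - y" for n t
  proof -
    have "((\<lambda>t. if n = 0 then y + t + d / 2 else if n = 1 then 1 else 0) has_real_derivative (if n = 0 then 1 else 0))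
        (at t within {- y<..})"
      by (auto intro!: derivative_eq_intros)
    from DERIV_diff[OF this DERIV_cmult[OF E_deriv[OF that], of "d\<^sup>2" n]]
    show ?thesis by (simp add: D_def)
  qed
  have D0: "D 0 t = log_mean (x + t) (y + t)" if "t > - y" for t
    using log_mean_eq[OF xy that] by (simp add: D_def E_def J_def d_def)
  have int: "is_interval {- y<..}" by (simp add: is_interval_convex_1)
  have "completely_monotonic_on (D 1) {- y<..}"
    unfolding completely_monotonic_on_def derivatives_on_def
  proof (intro conjI int exI[of _ "\<lambda>n. D (Suc n)"] allI ballI)
    fix n :: nat and t :: real assume t: "t \<in> {- y<..}"
    \<comment> \<open>The sign \<open>(- 1) ^ Suc n\<close> inside \<open>E (Suc n)\<close>, the
      minus sign in \<open>D\<close> and the prefactor \<open>(- 1) ^ n\<close> multiply to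
      1.\<close>
    have "(- 1) ^ n * D (Suc n) t = (if n = 0 then 1 else 0) + d\<^sup>2 * (fact (Suc n) * J (Suc n) t)"
      by (simp add: D_def E_def algebra_simps flip: power_add power_mult_distrib)
    also have "\<dots> \<ge> 0" using J_nonneg[of t "Suc n"] t by simp
    finally show "(- 1) ^ n * D (Suc n) t \<ge> 0" .
  qed (auto intro: D_deriv)
  moreover have "log_mean (x + t) (y + t) \<ge> 0" if "t > - y" for t
    unfolding log_mean_def using that xy by (intro divide_nonpos_nonpos) auto
  ultimately show ?thesis
    unfolding bernstein_on_def derivatives_on_def using int D0 D_deriv by (auto intro!: exI[of _ D])
qed

section \<open>Integral representation, its continuation, and the Bernstein property\<close>

text \<open>For \<open>Re z < - y\<close> the integrand grows exponentially, because
  \<open>P_fun x y s / s\<close> decays more slowly than any exponential. The formula on the rest of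
  the cut plane is therefore stated through \<open>R\<close>, the holomorphic continuation of the
  integral from the half plane \<open>Re z > - y\<close>.\<close>

theorem theorem4p1:
  fixes x y :: real
  assumes "x > y" and "y > 0"
  shows
    "(\<forall>z \<in> cut_plane y. Re z \<ge> - y \<longrightarrow>
        repr_integrand x y z integrable_on {0<..} \<and>
        clog_mean (of_real x + z) (of_real y + z) =
          of_real (log_mean x y) + z
          + of_real ((x - y) / pi) * integral {0<..} (repr_integrand x y z))
     \<and>
     (\<exists>R. R holomorphic_on cut_plane y \<and>
        (\<forall>z. Re z > - y \<longrightarrow> R z = integral {0<..} (repr_integrand x y z)) \<and>
        (\<forall>z \<in> cut_plane y.
           clog_mean (of_real x + z) (of_real y + z) =
             of_real (log_mean x y) + z + of_real ((x - y) / pi) * R z))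
     \<and>
     bernstein_on (\<lambda>t. log_mean (x + t) (y + t)) {t. t > - min x y}"
proof (intro conjI)
  show "\<forall>z \<in> cut_plane y. Re z \<ge> - y \<longrightarrow>
        repr_integrand x y z integrable_on {0<..} \<and>
        clog_mean (of_real x + z) (of_real y + z) =
          of_real (log_mean x y) + z
          + of_real ((x - y) / pi) * integral {0<..} (repr_integrand x y z)"
    using clog_mean_representation[OF assms] by blast
  define c where "c = complex_of_real ((x - y) / pi)"
  have c: "c \<noteq> 0" using assms by (simp add: c_def)
  \<comment> \<open>The desired identity is solved for \<open>R\<close>, so it holds by
    construction. What remains is holomorphy, where the difference of logarithms must not vanish,
    and agreement with the integral on the half plane.\<close>
  define R where "R = (\<lambda>z. (clog_mean (of_real x + z) (of_real y + z) - of_real (log_mean x y) - z) / c)"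
  have R: "clog_mean (of_real x + z) (of_real y + z) = of_real (log_mean x y) + z + c * R z" for z
    using c by (simp add: R_def)
  have "Ln (of_real x + z) - Ln (of_real y + z) \<noteq> 0" if "z \<in> cut_plane y" for z
    unfolding cut_plane_shift(4)[OF assms(1) that]
    by (rule Ln_diff_properties(2)[OF cut_plane_shift(1)[OF assms(1) that]])
  then have holo: "R holomorphic_on cut_plane y"
    unfolding R_def clog_mean_def using c cut_plane_shift(2,3)[OF assms(1)]
    by (intro holomorphic_intros) auto
  have eq: "R z = integral {0<..} (repr_integrand x y z)" if z: "Re z > - y" for z
  proof -
    have "z \<in> cut_plane y" using z by (auto simp: cut_plane_def)
    then have "c * R z = c * integral {0<..} (repr_integrand x y z)"
      using clog_mean_representation(2)[OF assms, of z] R[of z] z by (simp add: c_def)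
    then show ?thesis using c by simp
  qed
  show "\<exists>R. R holomorphic_on cut_plane y \<and>
        (\<forall>z. Re z > - y \<longrightarrow> R z = integral {0<..} (repr_integrand x y z)) \<and>
        (\<forall>z \<in> cut_plane y.
           clog_mean (of_real x + z) (of_real y + z) =
             of_real (log_mean x y) + z + of_real ((x - y) / pi) * R z)"
    using holo eq R unfolding c_def by blast
  have "{t. t > - min x y} = {- y<..}" using assms(1) by auto
  then show "bernstein_on (\<lambda>t. log_mean (x + t) (y + t)) {t. t > - min x y}"
    using bernstein_log_mean[OF assms(1)] by simp
qed

end
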